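(* Let $t\ge 2$ and let $\Pi=\{\pi_i\}_{i\in\mathbb{Z}}$ be an even-near-critical centrally symmetric allowable sequence of $2n$ points in noncentral general position with central signature $(d_1,d_2,\dots,d_t)$. Suppose that the first move (from $\pi_0$ to $\pi_1$) contains a crossing switch, and let $s_1$ be the corresponding crossing substring, of $2d_1$ points. Then for every $1\le k\le d_1$, $$\gamma(s_1(k))=\mathrm{C}\,\mathrm{P}^{k-1}\,\mathrm{R}^{n-d_1}\,\mathrm{P}^{2(d_1-k)+1}\,\mathrm{L}^{n-d_1}\,\mathrm{P}^{k-1},$$ and so $$\gamma(\overline{s_1(k)})=\mathrm{C}\,\mathrm{P}^{k-1}\,\mathrm{L}^{n-d_1}\,\mathrm{P}^{2(d_1-k)+1}\,\mathrm{R}^{n-d_1}\,\mathrm{P}^{k-1},$$ where $X^m$ denotes the letter $X$ repeated $m$ times.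
   Context: An allowable sequence on a finite set of $N$ points is a doubly infinite sequence $\Pi=\{\pi_i\}_{i\in\mathbb{Z}}$ of permutations (linear orderings) of the points such that: (i) there is a positive integer $h=h(\Pi)$ such that $\pi_{i+h}$ is the reversal of $\pi_i$ for all $i$ (then $\pi_0,\dots,\pi_h$ is called a halfperiod, of length $h$); (ii) $\pi_i$ is obtained from $\pi_{i-1}$ by reversing one or more disjoint substrings of consecutive elements; these reversals are called switches, and the set of switches from $\pi_{i-1}$ to $\pi_i$ is the $i$-th move; (iii) any pair of points participates together in a switch exactly once within a halfperiod. A switch of two points is a transposition. Write $\pi(p)$ for the position of the point $p$ in $\pi$. An allowable sequence with $2n$ points is centrally symmetric if for every point $p$ there is a point $\overline p$ (its conjugate) with $\pi(p)+\pi(\overline p)=2n+1$ for every permutation $\pi$ of the sequence. A crossing switch is a switch reversing a centered substring of a permutation. The sequence is in noncentral general position if all switches except possibly crossing switches are transpositions. It is even-near-critical if $h(\Pi)=2n$. Its central signature is $(d_1,\dots,d_t)$, where $2d_i$ is the number of points reversed by the $i$-th crossing switch in the halfperiod $\pi_0,\pi_1,\dots,\pi_h$. The substring $s_i=(s_i(1),\dots,s_i(2d_i))$ reversed by the $i$-th crossing switch, read just before it is reversed, is called the $i$-th crossing substring; $\overline{s_i(k)}=s_i(2d_i+1-k)$. The path $\gamma(p)$ of a point $p$ is the word of length $2n$ in the letters C, P, R, L whose $i$-th letter ($1\le i\le 2n$) is: C if $p$ participates in a crossing switch from $\pi_{i-1}$ to $\pi_i$; P if $p$ participates in no switch from $\pi_{i-1}$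 to $\pi_i$; R (resp. L) if (through a non-crossing switch) the position of $p$ in $\pi_i$ is to the right (resp. left) of its position in $\pi_{i-1}$. *)

theory Defs
  imports Main
begin

text \<open>A permutation of the points is a duplicate-free list. \<open>move B xs ys\<close> says that \<open>ys\<close> arises
  from \<open>xs\<close> by reversing disjoint substrings: \<open>xs\<close> is cut into the nonempty blocks \<open>B\<close>; the blocks
  with at least two elements are the reversed substrings, singleton blocks are the points that stay
  fixed. At least one substring has to be reversed.\<close>

definition move :: "'a list list \<Rightarrow> 'a list \<Rightarrow> 'a list \<Rightarrow> bool" where
  "move B xs ys \<longleftrightarrow>
     [] \<notin> set B \<and> (\<exists>s\<in>set B. 2 \<le> length s) \<and> xs = concat B \<and> ys = concat (map rev B)"

definition switches :: "'a list \<Rightarrow> 'a list \<Rightarrow> 'a list set" where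
  "switches xs ys = {s. \<exists>B. move B xs ys \<and> s \<in> set B \<and> 2 \<le> length s}"

text \<open>The two permutations determine the cut into blocks, so the set of switches of a move is a
  function of the permutations before and after it.\<close>

lemma move_blocks_unique:
  assumes "distinct xs" "move B xs ys" "move B' xs ys"
  shows "B = B'"
proof -
  have unique: "B = B'"
    if "distinct (concat B)" "concat B = concat B'"
      "concat (map rev B) = concat (map rev B')" "[] \<notin> set B" "[] \<notin> set B'"
    for B B' :: "'a list list"
    using that
  proof (induction B arbitrary: B')
    case Nil
    then show ?case by (cases B') auto
  next
    case (Cons b Bs)
    from Cons.prems obtain b' Bs' where B': "B' = b' # Bs'" by (cases B') auto
    from Cons.prems B' obtain x c c' where c: "b = x # c" "b' = x # c'"
      by (cases b; cases b') auto
    have d: "x \<notin> set (rev c)" "x \<notin> set (concat (map rev Bs))"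
      using Cons.prems(1) c by auto
    have eq: "rev c @ x # concat (map rev Bs) = rev c' @ x # concat (map rev Bs')"
      using Cons.prems(3) c B' by simp
    have "rev c = rev c' \<and> concat (map rev Bs) = concat (map rev Bs')"
      using eq append_Cons_eq_iff[OF d] by blast
    then show ?case using Cons.IH[of Bs'] Cons.prems c B' by auto
  qed
  show ?thesis using assms by (intro unique) (simp_all add: move_def)
qed

text \<open>The halfperiod length \<open>h\<close> is a parameter. Condition \<open>switch_once\<close> is stated for the halfperiod
  \<open>\<pi> 0, \<dots>, \<pi> h\<close>; by \<open>reversal\<close> the pairs switched in move \<open>i + h\<close> are those switched in move \<open>i\<close>, so
  the same then holds for every \<open>\<pi> j, \<dots>, \<pi> (j + h)\<close>.\<close>

locale allowable_sequence =
  fixes S :: "'a set" and \<pi> :: "int \<Rightarrow> 'a list" and h :: nat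
  assumes finite_points: "finite S"
    and permutation: "distinct (\<pi> i)" "set (\<pi> i) = S"
    and halfperiod_pos: "0 < h"
    and reversal: "\<pi> (i + int h) = rev (\<pi> i)"
    and moves: "\<exists>B. move B (\<pi> (i - 1)) (\<pi> i)"
    and switch_once: "\<lbrakk>p \<in> S; q \<in> S; p \<noteq> q\<rbrakk> \<Longrightarrow>
      \<exists>!i. i \<in> {1..int h} \<and> (\<exists>s\<in>switches (\<pi> (i - 1)) (\<pi> i). p \<in> set s \<and> q \<in> set s)"

text \<open>Positions are counted from 1.\<close>

definition pos :: "'a list \<Rightarrow> 'a \<Rightarrow> nat" where
  "pos xs p = Suc (LEAST j. j < length xs \<and> xs ! j = p)"

definition is_conjugate :: "'a set \<Rightarrow> (int \<Rightarrow> 'a list) \<Rightarrow> 'a \<Rightarrow> 'a \<Rightarrow> bool" where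
  "is_conjugate S \<pi> p q \<longleftrightarrow> q \<in> S \<and> (\<forall>i. pos (\<pi> i) p + pos (\<pi> i) q = card S + 1)"

definition centrally_symmetric :: "'a set \<Rightarrow> (int \<Rightarrow> 'a list) \<Rightarrow> bool" where
  "centrally_symmetric S \<pi> \<longleftrightarrow> even (card S) \<and> (\<forall>p\<in>S. \<exists>q. is_conjugate S \<pi> p q)"

definition conjugate_point :: "'a set \<Rightarrow> (int \<Rightarrow> 'a list) \<Rightarrow> 'a \<Rightarrow> 'a" where
  "conjugate_point S \<pi> p = (THE q. is_conjugate S \<pi> p q)"

definition crossing_switch :: "'a list \<Rightarrow> 'a list \<Rightarrow> 'a list \<Rightarrow> bool" where
  "crossing_switch xs ys s \<longleftrightarrow>
     s \<in> switches xs ys \<and> (\<exists>u v. xs = u @ s @ v \<and> length u = length v)"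

definition noncentral_general_position :: "(int \<Rightarrow> 'a list) \<Rightarrow> bool" where
  "noncentral_general_position \<pi> \<longleftrightarrow>
     (\<forall>i. \<forall>s\<in>switches (\<pi> (i - 1)) (\<pi> i).
        \<not> crossing_switch (\<pi> (i - 1)) (\<pi> i) s \<longrightarrow> length s = 2)"

text \<open>A move has at most one crossing switch, so the crossing switches of a halfperiod are listed by
  the moves containing them.\<close>

definition crossing_moves :: "(int \<Rightarrow> 'a list) \<Rightarrow> nat \<Rightarrow> int list" where
  "crossing_moves \<pi> h = filter (\<lambda>i. \<exists>s. crossing_switch (\<pi> (i - 1)) (\<pi> i) s) [1..int h]"

definition central_signature :: "(int \<Rightarrow> 'a list) \<Rightarrow> nat \<Rightarrow> nat list \<Rightarrow> bool" where
  "central_signature \<pi> h d \<longleftrightarrow>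
     list_all2 (\<lambda>i di. \<exists>s. crossing_switch (\<pi> (i - 1)) (\<pi> i) s \<and> length s = 2 * di)
       (crossing_moves \<pi> h) d"

definition even_near_critical :: "'a set \<Rightarrow> nat \<Rightarrow> bool" where
  "even_near_critical S h \<longleftrightarrow> even (card S) \<and> h = card S"

datatype path_letter = C | P | R | L

text \<open>The middle point of a non-crossing switch of odd length would move neither right nor left;
  such switches are excluded by \<open>noncentral_general_position\<close>, so the final \<open>else\<close> branch means a
  move to the left.\<close>

definition path_step :: "(int \<Rightarrow> 'a list) \<Rightarrow> 'a \<Rightarrow> int \<Rightarrow> path_letter" where
  "path_step \<pi> p i =
     (if \<exists>s. crossing_switch (\<pi> (i - 1)) (\<pi> i) s \<and> p \<in> set s then C
      else if \<forall>s\<in>switches (\<pi> (i - 1)) (\<pi> i). p \<notin> set s then P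
      else if pos (\<pi> (i - 1)) p < pos (\<pi> i) p then R
      else L)"

definition point_path :: "nat \<Rightarrow> (int \<Rightarrow> 'a list) \<Rightarrow> 'a \<Rightarrow> path_letter list" where
  "point_path n \<pi> p = map (path_step \<pi> p) [1..int (2 * n)]"

end

theory Submission
  imports Defs
begin

text \<open>
  By central symmetry it is enough to watch the right half. Each crossing switch
  exchanges the two halves of a centered substring, so a point that crosses to the right in move
  \<open>c\<close> stays in the right half until it crosses back in move \<open>c + 2n\<close>. Let \<open>p\<close> be such a point, let \<open>d\<^sub>c\<close>
  be the number of points that cross to the right together with \<open>p\<close>, and let \<open>k\<close> be the rank of \<open>p\<close>
  among them, counted from the outside. Each of the other \<open>n - d\<^sub>c\<close> points \<open>y\<close> of the right
  half leaves it in a crossing move \<open>e\<close> with \<open>c < e < c + 2n\<close>. Just after move \<open>c\<close> the point \<open>p\<close> is nearer to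
  the center than \<open>y\<close>, just before move \<open>e\<close> it is farther away, so \<open>p\<close> and \<open>y\<close> meet in between, and these
  meetings are precisely the letters R of \<open>p\<close>. A point takes part in only one transposition per move,
  and \<open>y\<close> meets the \<open>d\<^sub>c\<close> points in the order from outermost to innermost, so all the letters R of \<open>p\<close> lie in
  distinct moves from \<open>c + k\<close> on (\<open>meet_lower\<close>). It remains to see that they all
  occur before move \<open>c + k + n - d\<^sub>c\<close>.

  The same counting shows that crossing moves \<open>c\<close> and \<open>e\<close> that follow each other are at least \<open>d\<^sub>c + d\<^sub>e\<close> moves
  apart. The sum of these lower bounds over a halfperiod is \<open>2n\<close>, which is the length of
  the halfperiod, so all of them are equalities (\<open>crossing_distance\<close>). This lack of slack yields the key
  estimate \<open>meet_bound\<close>: \<open>p\<close> meets \<open>y\<close> before move \<open>c\<close> plus the sum of the \<open>d\<^sub>i\<close> over \<open>c \<le> i \<le> e\<close>. By induction,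
  from the crossing move \<open>f\<close> following \<open>c\<close> on, the outermost point \<open>z\<close> that crosses
  in move \<open>f\<close> is busy in every move with points that are not \<open>p\<close> until it has met \<open>y\<close>. So
  \<open>z\<close> is still inside \<open>p\<close> when it meets \<open>y\<close>; since \<open>y\<close> comes from outside, it has met \<open>p\<close> before. Thus \<open>y\<close> has met all
  \<open>d\<^sub>c\<close> points that cross in move \<open>c\<close> before move \<open>c + n\<close>, and as the \<open>d\<^sub>c - k\<close> points inside \<open>p\<close> follow \<open>p\<close> one
  per move, it meets \<open>p\<close> before move \<open>c + k + n - d\<^sub>c\<close>.

  The letters L follow by applying the result on the letters R to the sequence run
  backwards, and the path of the conjugate point is the mirror image.
\<close>

section \<open>Centrally symmetric motions\<close>

text \<open>Only the order of the points at each time matters, so the points are treated as moving on a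
  line with center \<open>0\<close>, and which points are switched is read off from their coordinates.\<close>

definition swap :: "(int \<Rightarrow> 'a \<Rightarrow> int) \<Rightarrow> int \<Rightarrow> 'a \<Rightarrow> 'a \<Rightarrow> bool" where
  "swap x i p q \<longleftrightarrow> (x (i - 1) p < x (i - 1) q) \<noteq> (x i p < x i q)"

definition cross :: "(int \<Rightarrow> 'a \<Rightarrow> int) \<Rightarrow> int \<Rightarrow> 'a \<Rightarrow> bool" where
  "cross x i p \<longleftrightarrow> (x (i - 1) p < 0) \<noteq> (x i p < 0)"

text \<open>The properties of the sequence of permutations that the counting uses, in a form that is invariant under
  reversal of time. Here \<open>x i p\<close> is the signed position of \<open>p\<close> at time \<open>i\<close>, and the last three assumptions
  say that the points crossing in a move form one switch while every other switch is a transposition.\<close>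

locale central_motion =
  fixes S :: "'a set" and n :: nat and x :: "int \<Rightarrow> 'a \<Rightarrow> int" and bar :: "'a \<Rightarrow> 'a"
  assumes finite_S: "finite S" and card_S: "card S = 2 * n"
    and bar_in: "p \<in> S \<Longrightarrow> bar p \<in> S"
    and inj_x: "inj_on (x i) S"
    and x_bar: "p \<in> S \<Longrightarrow> x i (bar p) = - x i p"
    and x_nonzero: "p \<in> S \<Longrightarrow> x i p \<noteq> 0"
    and x_antiperiodic: "p \<in> S \<Longrightarrow> x (i + 2 * int n) p = - x i p"
    and swap_once: "\<lbrakk>p \<in> S; q \<in> S; p \<noteq> q\<rbrakk> \<Longrightarrow> \<exists>!i. i \<in> {1..2 * int n} \<and> swap x i p q"
    and cross_swap: "\<lbrakk>p \<in> S; q \<in> S; p \<noteq> q; cross x i p; cross x i q\<rbrakk> \<Longrightarrow> swap x i p q"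
    and swap_cross: "\<lbrakk>p \<in> S; q \<in> S; cross x i p; swap x i p q\<rbrakk> \<Longrightarrow> cross x i q"
    and swap_partner: "\<lbrakk>p \<in> S; q \<in> S; r \<in> S; \<not> cross x i p; swap x i p q; swap x i p r\<rbrakk> \<Longrightarrow> q = r"
begin

lemma x_eq_iff: "p \<in> S \<Longrightarrow> q \<in> S \<Longrightarrow> x i p = x i q \<longleftrightarrow> p = q"
  using inj_x[of i] by (auto simp: inj_on_def)

lemma bar_neq: "p \<in> S \<Longrightarrow> bar p \<noteq> p"
  using x_bar[of p 0] x_nonzero[of p 0] by force

lemma bar_bar: "p \<in> S \<Longrightarrow> bar (bar p) = p"
  using x_bar[of p 0] x_bar[of "bar p" 0] bar_in x_eq_iff[of "bar (bar p)" p 0] by auto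

lemma swap_sym: "p \<in> S \<Longrightarrow> q \<in> S \<Longrightarrow> swap x i p q \<longleftrightarrow> swap x i q p"
  using x_eq_iff[of p q i] x_eq_iff[of p q "i - 1"] unfolding swap_def by auto

lemma swap_neq: "swap x i p q \<Longrightarrow> p \<noteq> q"
  by (auto simp: swap_def)

lemma cross_iff_swap_bar: "p \<in> S \<Longrightarrow> cross x i p \<longleftrightarrow> swap x i p (bar p)"
  by (simp add: cross_def swap_def x_bar)

lemma swap_periodic:
  assumes "p \<in> S" "q \<in> S" shows "swap x (i + 2 * int n) p q \<longleftrightarrow> swap x i p q"
proof -
  have "x (i + 2 * int n - 1) r = - x (i - 1) r" if "r \<in> S" for r
    using x_antiperiodic[OF that, of "i - 1"] by (simp add: algebra_simps)
  then show ?thesis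
    using assms x_eq_iff[of p q i] x_eq_iff[of p q "i - 1"]
    by (auto simp: swap_def x_antiperiodic)
qed

lemma swap_periodic_mult:
  assumes "p \<in> S" "q \<in> S" shows "swap x (i + m * (2 * int n)) p q \<longleftrightarrow> swap x i p q"
proof (induction m rule: int_induct[where k = 0])
  case (step1 m)
  then show ?case using swap_periodic[OF assms, of "i + m * (2 * int n)"] by (simp add: algebra_simps)
next
  case (step2 m)
  then show ?case using swap_periodic[OF assms, of "i + (m - 1) * (2 * int n)"] by (simp add: algebra_simps)
qed simp

lemma n_pos: "p \<in> S \<Longrightarrow> 0 < n"
  using finite_S card_S by (cases n) auto

text \<open>The representative of a move in \<open>{1..2 * n}\<close>, the window for which \<open>swap_once\<close> is stated. It serves
  to extend that property to arbitrary windows of length \<open>2 * n\<close>.\<close>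

definition residue :: "int \<Rightarrow> int" where
  "residue i = (i - 1) mod (2 * int n) + 1"

lemma swap_residue:
  assumes "p \<in> S" "q \<in> S" shows "swap x (residue i) p q \<longleftrightarrow> swap x i p q"
proof -
  have "residue i + ((i - 1) div (2 * int n)) * (2 * int n) = i"
    unfolding residue_def using div_mult_mod_eq[of "i - 1" "2 * int n"] by linarith
  then show ?thesis using swap_periodic_mult[OF assms] by metis
qed

lemma swap_exists:
  assumes "p \<in> S" "q \<in> S" "p \<noteq> q"
  shows "\<exists>i. c < i \<and> i \<le> c + 2 * int n \<and> swap x i p q"
proof -
  obtain i where i: "i \<in> {1..2 * int n}" "swap x i p q" using swap_once[OF assms] by blast
  define m where "m = (i - c - 1) div (2 * int n)"
  have n: "0 < 2 * int n" using n_pos assms by simp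
  have "i - c - 1 = m * (2 * int n) + (i - c - 1) mod (2 * int n)"
    unfolding m_def by (simp add: div_mult_mod_eq)
  moreover have "0 \<le> (i - c - 1) mod (2 * int n)" "(i - c - 1) mod (2 * int n) < 2 * int n"
    using n by (simp_all add: pos_mod_bound)
  moreover have "swap x (i + (-m) * (2 * int n)) p q" using swap_periodic_mult assms i by blast
  ultimately show ?thesis by (intro exI[of _ "i + (-m) * (2 * int n)"]) (simp add: algebra_simps)
qed

lemma swap_unique:
  assumes "p \<in> S" "q \<in> S" "swap x i p q" "swap x j p q" "i < j + 2 * int n" "j < i + 2 * int n"
  shows "i = j"
proof -
  have n: "0 < 2 * int n" using n_pos assms by simp
  have "residue k \<in> {1..2 * int n}" for k
    unfolding residue_def using pos_mod_bound[OF n, of "k - 1"] pos_mod_sign[OF n, of "k - 1"] by auto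
  then have "residue i = residue j"
    using swap_once[OF assms(1,2) swap_neq[OF assms(3)]] assms swap_residue by blast
  then have "(2 * int n) dvd (i - j)"
    unfolding residue_def using mod_eq_dvd_iff[of "i - 1" "2 * int n" "j - 1"] by simp
  then obtain m where m: "i - j = 2 * int n * m" by blast
  have "\<bar>m\<bar> < 1"
  proof (rule ccontr)
    assume "\<not> \<bar>m\<bar> < 1"
    then have "2 * int n * 1 \<le> 2 * int n * \<bar>m\<bar>" using n by (intro mult_left_mono) auto
    also have "\<dots> = \<bar>i - j\<bar>" using m n by (simp add: abs_mult)
    finally show False using assms(5,6) by linarith
  qed
  then show ?thesis using m by simp
qed

lemma order_change:
  assumes "i \<le> j" "(x i p < x i q) \<noteq> (x j p < x j q)"
  shows "\<exists>k. i < k \<and> k \<le> j \<and> swap x k p q"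
  using assms
proof (induction j rule: int_ge_induct)
  case (step j)
  then show ?case
    by (cases "(x i p < x i q) \<noteq> (x j p < x j q)") (fastforce simp: swap_def)+
qed simp

lemma cross_sign:
  assumes "p \<in> S" "cross x c p" "c \<le> i" "i < c + 2 * int n"
  shows "0 < x i p \<longleftrightarrow> 0 < x c p"
proof (rule ccontr)
  assume "\<not> ?thesis"
  then have "(x c p < x c (bar p)) \<noteq> (x i p < x i (bar p))"
    using x_bar[OF assms(1)] by auto (metis x_nonzero assms(1) linorder_neqE)+
  from order_change[OF assms(3) this] obtain k
    where "c < k" "k \<le> i" "swap x k p (bar p)" by blast
  moreover have "swap x c p (bar p)" using assms cross_iff_swap_bar by blast
  ultimately show False using swap_unique[of p "bar p" k c] assms bar_in by auto
qed

lemma cross_sign_before: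
  assumes "p \<in> S" "cross x e p" "e - 2 * int n \<le> i" "i < e"
  shows "0 < x i p \<longleftrightarrow> 0 < x (e - 1) p"
proof (rule ccontr)
  assume "\<not> ?thesis"
  then have "(x i p < x i (bar p)) \<noteq> (x (e - 1) p < x (e - 1) (bar p))"
    using x_bar[OF assms(1)] by auto (metis x_nonzero assms(1) linorder_neqE)+
  from order_change[OF _ this] obtain k
    where "i < k" "k \<le> e - 1" "swap x k p (bar p)" using assms by auto
  moreover have "swap x e p (bar p)" using assms cross_iff_swap_bar by blast
  ultimately show False using swap_unique[of p "bar p" k e] assms bar_in by auto
qed

lemma cross_unique:
  assumes "p \<in> S" "cross x i p" "cross x j p" "i < j + 2 * int n" "j < i + 2 * int n"
  shows "i = j"
  using assms swap_unique[of p "bar p" i j] bar_in cross_iff_swap_bar by blast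

lemma cross_exists:
  assumes "p \<in> S" shows "\<exists>i. c < i \<and> i \<le> c + 2 * int n \<and> cross x i p"
  using swap_exists[of p "bar p" c] assms bar_in bar_neq cross_iff_swap_bar by metis

lemma cross_periodic: "p \<in> S \<Longrightarrow> cross x (i + 2 * int n) p \<longleftrightarrow> cross x i p"
  using swap_periodic[of p "bar p"] bar_in cross_iff_swap_bar by blast

lemma cross_bar: "p \<in> S \<Longrightarrow> cross x i (bar p) \<longleftrightarrow> cross x i p"
  using swap_sym[of p "bar p"] bar_in bar_bar cross_iff_swap_bar by simp

text \<open>A point \<open>q\<close> of the right half nearer to the center than a crossing point \<open>p\<close> would lie between \<open>p\<close>
  and its conjugate; these change order, so \<open>q\<close> would be swapped with one of them and thus cross too.\<close>

lemma cross_innermost: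
  assumes "p \<in> S" "q \<in> S" "cross x i p" "\<not> cross x i q" "j = i \<or> j = i - 1" "0 < x j p" "0 < x j q"
  shows "x j p < x j q"
proof (rule ccontr)
  assume "\<not> ?thesis"
  then have "x j q < x j p" using x_eq_iff[of p q j] assms by fastforce
  moreover have "\<not> swap x i p q" using swap_cross assms by blast
  moreover have "\<not> swap x i (bar p) q"
    using swap_cross[of "bar p" q i] cross_bar bar_in assms by blast
  ultimately show False using assms x_bar[of p i] x_bar[of p "i - 1"] unfolding swap_def cross_def
    by (smt (verit))
qed

lemma cross_reverses:
  assumes "p \<in> S" "q \<in> S" "cross x i p" "cross x i q"
  shows "x (i - 1) p \<le> x (i - 1) q \<longleftrightarrow> x i q \<le> x i p"
  using cross_swap[OF assms(1,2) _ assms(3,4)] x_eq_iff[OF assms(1,2), of i]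
    x_eq_iff[OF assms(1,2), of "i - 1"]
  by (cases "p = q") (auto simp: swap_def)

section \<open>Crossing points\<close>

text \<open>Both names describe the motion in the right half, which the outgoing points of a move enter at
  the center and which the incoming points leave there.\<close>

definition outgoing :: "int \<Rightarrow> 'a set" where
  "outgoing c = {p \<in> S. cross x c p \<and> 0 < x c p}"

definition incoming :: "int \<Rightarrow> 'a set" where
  "incoming e = {p \<in> S. cross x e p \<and> 0 < x (e - 1) p}"

text \<open>The entry of the central signature that belongs to a crossing move, and \<open>0\<close> for any other move.\<close>

definition weight :: "int \<Rightarrow> nat" where
  "weight c = card (outgoing c)"

lemma finite_outgoing: "finite (outgoing c)" and finite_incoming: "finite (incoming c)"
  using finite_S by (auto simp: outgoing_def incoming_def)

lemma incoming_eq: "incoming c = {p \<in> S. cross x c p \<and> x c p < 0}"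
  unfolding incoming_def cross_def
  by (smt (verit, best) Collect_cong x_nonzero)

lemma outgoing_eq: "outgoing c = {p \<in> S. cross x c p \<and> x (c - 1) p < 0}"
  unfolding outgoing_def cross_def
  by (smt (verit, best) Collect_cong x_nonzero)

lemma incoming_eq_bar: "incoming c = bar ` outgoing c"
proof (intro equalityI subsetI)
  fix p assume "p \<in> incoming c"
  then have "bar p \<in> outgoing c" "p = bar (bar p)"
    by (auto simp: incoming_eq outgoing_def bar_in cross_bar x_bar bar_bar)
  then show "p \<in> bar ` outgoing c" by blast
qed (auto simp: incoming_eq outgoing_def bar_in cross_bar x_bar)

lemma card_incoming: "card (incoming c) = weight c"
  unfolding incoming_eq_bar weight_def
  by (intro card_image inj_onI) (metis (lifting) bar_bar mem_Collect_eq outgoing_def)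

lemma card_crossing: "card {p \<in> S. cross x c p} = 2 * weight c"
proof -
  have "{p \<in> S. cross x c p} = outgoing c \<union> incoming c"
    using x_nonzero by (auto simp: outgoing_def incoming_eq neq_iff)
  moreover have "outgoing c \<inter> incoming c = {}" by (auto simp: outgoing_def incoming_eq)
  ultimately show ?thesis
    using card_Un_disjoint[OF finite_outgoing finite_incoming, of c c] card_incoming
    by (simp add: weight_def)
qed

lemma incoming_disjoint:
  assumes "i \<in> I" "j \<in> I" "I \<subseteq> {c<..c + 2 * int n}" "i \<noteq> j"
  shows "incoming i \<inter> incoming j = {}"
proof -
  have "i \<in> {c<..c + 2 * int n}" "j \<in> {c<..c + 2 * int n}" using assms by blast+
  then show ?thesis using cross_unique[of _ i j] assms(4) by (auto simp: incoming_def)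
qed

lemma card_incoming_Union:
  assumes "I \<subseteq> {c<..c + 2 * int n}"
  shows "card (\<Union>i\<in>I. incoming i) = (\<Sum>i\<in>I. weight i)"
proof -
  have "finite I" using assms finite_subset by blast
  then show ?thesis
    using card_UN_disjoint[of I incoming] incoming_disjoint[OF _ _ assms] finite_incoming card_incoming
    by simp
qed

text \<open>Every point crosses exactly once in a window of \<open>2 * n\<close> moves, together with its conjugate.\<close>

lemma sum_weight: "(\<Sum>i\<in>{c<..c + 2 * int n}. weight i) = n"
proof -
  have "S = (\<Union>i\<in>{c<..c + 2 * int n}. {p \<in> S. cross x i p})"
    using cross_exists[of _ c] by (fastforce simp: Bex_def)
  also have "card \<dots> = (\<Sum>i\<in>{c<..c + 2 * int n}. card {p \<in> S. cross x i p})"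
    using finite_S cross_unique by (intro card_UN_disjoint) fastforce+
  finally show ?thesis using card_S by (simp add: card_crossing flip: sum_distrib_left)
qed

lemma weight_periodic: "weight (c + 2 * int n) = weight c"
proof -
  have "{p \<in> S. cross x (c + 2 * int n) p} = {p \<in> S. cross x c p}" using cross_periodic by blast
  then show ?thesis using card_crossing[of c] card_crossing[of "c + 2 * int n"] by simp
qed

section \<open>Meetings in the right half\<close>

definition meet :: "int \<Rightarrow> 'a \<Rightarrow> 'a \<Rightarrow> int" where
  "meet c p q = (THE i. c < i \<and> i \<le> c + 2 * int n \<and> swap x i p q)"

lemma meet_eq:
  assumes "p \<in> S" "q \<in> S" "c < i" "i \<le> c + 2 * int n" "swap x i p q"
  shows "meet c p q = i"
  unfolding meet_def using assms swap_unique[OF assms(1,2) _ assms(5)] by (intro the_equality) auto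

lemma outgoing_before_incoming:
  assumes "p \<in> outgoing c" "y \<in> incoming e" "c < e" "e < c + 2 * int n"
  shows "p \<in> S" "y \<in> S" "p \<noteq> y" "x c p < x c y" "x (e - 1) y < x (e - 1) p"
    "\<And>i. c < i \<Longrightarrow> i < c + 2 * int n \<Longrightarrow> \<not> cross x i p"
    "\<And>i. e - 2 * int n < i \<Longrightarrow> i < e \<Longrightarrow> \<not> cross x i y"
proof -
  show S: "p \<in> S" "y \<in> S" using assms by (auto simp: outgoing_def incoming_def)
  have cr: "cross x c p" "cross x e y" "0 < x c p" "0 < x (e - 1) y"
    using assms by (auto simp: outgoing_def incoming_def)
  show np: "\<not> cross x i p" if "c < i" "i < c + 2 * int n" for i
    using cross_unique[OF S(1) _ cr(1), of i] that by auto
  show ny: "\<not> cross x i y" if "e - 2 * int n < i" "i < e" for i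
    using cross_unique[OF S(2) _ cr(2), of i] that by auto
  show "p \<noteq> y" using np[of e] cr assms by auto
  have "0 < x c y" using cross_sign_before[OF S(2) cr(2), of c] cr assms by auto
  then show "x c p < x c y" using cross_innermost[OF S cr(1) ny] cr assms by auto
  have "0 < x (e - 1) p" using cross_sign[OF S(1) cr(1), of "e - 1"] cr assms by auto
  then show "x (e - 1) y < x (e - 1) p"
    using cross_innermost[OF S(2) S(1) cr(2) np] cr assms by auto
qed

text \<open>The two points start in the order \<open>p\<close>, \<open>y\<close> at time \<open>c\<close> and end in the order \<open>y\<close>, \<open>p\<close> at time \<open>e - 1\<close>, and
  a window of length \<open>2 * n\<close> has room for a single swap of them.\<close>

lemma meet:
  assumes "p \<in> outgoing c" "y \<in> incoming e" "c < e" "e < c + 2 * int n"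
  shows "swap x (meet c p y) p y" "c < meet c p y" "meet c p y < e"
    "\<And>i. c \<le> i \<Longrightarrow> i < meet c p y \<Longrightarrow> x i p < x i y"
    "\<And>i. meet c p y \<le> i \<Longrightarrow> i < e \<Longrightarrow> x i y < x i p"
proof -
  note o = outgoing_before_incoming[OF assms]
  obtain k where k: "c < k" "k \<le> e - 1" "swap x k p y"
    using order_change[of c "e - 1" p y] o assms by auto
  then have [simp]: "meet c p y = k" using assms o by (intro meet_eq) auto
  show "swap x (meet c p y) p y" "c < meet c p y" "meet c p y < e" using k by auto
  have un: "j = k" if "c < j" "j < e" "swap x j p y" for j
    using swap_unique[of p y j k] that k o assms by auto
  show "x i p < x i y" if i: "c \<le> i" "i < meet c p y" for i
  proof (rule ccontr)
    assume "\<not> x i p < x i y"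
    then obtain j where "c < j" "j \<le> i" "swap x j p y"
      using order_change[of c i p y] o(4) i by blast
    with un[of j] i k show False by auto
  qed
  show "x i y < x i p" if i: "meet c p y \<le> i" "i < e" for i
  proof (rule ccontr)
    assume "\<not> x i y < x i p"
    then have "(x i p < x i y) \<noteq> (x (e - 1) p < x (e - 1) y)" using o x_eq_iff[of p y i] by force
    then obtain j where "i < j" "j \<le> e - 1" "swap x j p y"
      using order_change[of i "e - 1" p y] i by auto
    with un[of j] i k show False by auto
  qed
qed

lemma meet_less:
  assumes "p \<in> outgoing c" "y \<in> incoming e" "c < e" "e < c + 2 * int n"
    and "i < e" "c \<le> i" "x i y < x i p"
  shows "meet c p y \<le> i"
  using meet(4)[OF assms(1-4), of i] assms(5-7) by force

text \<open>Points that cross together keep their order until they cross back. When \<open>y\<close>, coming from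
  outside, passes the inner point \<open>p\<close>, it must have passed the outer point \<open>q\<close> already.\<close>

lemma meet_mono_outgoing:
  assumes "p \<in> outgoing c" "q \<in> outgoing c" "y \<in> incoming e" "c < e" "e < c + 2 * int n"
    and "x c p < x c q"
  shows "meet c q y < meet c p y"
proof -
  define i where "i = meet c p y"
  note p = meet[OF assms(1,3-5), folded i_def] and q = meet[OF assms(2,3-5)]
  note o = outgoing_before_incoming[OF assms(1,3-5)] outgoing_before_incoming[OF assms(2,3-5)]
  have "swap x c p q" using cross_swap[of p q c] assms by (auto simp: outgoing_def)
  then have "\<not> swap x j p q" if "c < j" "j \<le> i" for j
    using swap_unique[of p q j c] o that p assms by auto
  then have "x i p < x i q" using order_change[of c i p q] p assms(6) by auto
  then have "meet c q y \<le> i" using meet_less[OF assms(2,3-5), of i] p by fastforce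
  moreover have "meet c q y \<noteq> i"
    using swap_partner[of y p q i] swap_sym[of y] o p q assms by fastforce
  ultimately show ?thesis by (simp add: i_def)
qed

text \<open>With \<open>s\<close> the crossing substring of move \<open>c\<close>, the point \<open>s(k)\<close> of its left half has rank \<open>k\<close>:
  after the reversal the points \<open>s(1), \<dots>, s(k)\<close> are those at least as far from the center.\<close>

definition rank :: "int \<Rightarrow> 'a \<Rightarrow> nat" where
  "rank c p = card {q \<in> outgoing c. x c p \<le> x c q}"

lemma rank_complement: "rank c p + card {q \<in> outgoing c. x c q < x c p} = weight c"
proof -
  have "outgoing c = {q \<in> outgoing c. x c p \<le> x c q} \<union> {q \<in> outgoing c. x c q < x c p}" by auto
  then show ?thesis unfolding rank_def weight_def
    using finite_outgoing by (subst card_Un_disjoint[symmetric]) auto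
qed

lemma meet_inj_outgoing:
  assumes "y \<in> incoming e" "c < e" "e < c + 2 * int n"
  shows "inj_on (\<lambda>q. meet c q y) (outgoing c)"
proof (rule inj_onI)
  fix q r assume qr: "q \<in> outgoing c" "r \<in> outgoing c" "meet c q y = meet c r y"
  then show "q = r" using meet_mono_outgoing[OF qr(1,2) assms]
      meet_mono_outgoing[OF qr(2,1) assms] x_eq_iff[of q r c]
    by (fastforce simp: outgoing_def)
qed

text \<open>Before \<open>p\<close> can meet \<open>y\<close>, all outgoing points outside \<open>p\<close> have to meet \<open>y\<close>, one per move.\<close>

lemma meet_lower:
  assumes "p \<in> outgoing c" "y \<in> incoming e" "c < e" "e < c + 2 * int n"
  shows "c + int (rank c p) \<le> meet c p y"
proof -
  let ?A = "{q \<in> outgoing c. x c p \<le> x c q}"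
  have "rank c p = card ((\<lambda>q. meet c q y) ` ?A)"
    unfolding rank_def using meet_inj_outgoing[OF assms(2-4)]
    by (intro card_image[symmetric]) (auto intro: inj_on_subset)
  also have "\<dots> \<le> card {c<..meet c p y}"
  proof (intro card_mono subsetI, simp)
    fix i assume "i \<in> (\<lambda>q. meet c q y) ` ?A"
    then obtain q where q: "q \<in> outgoing c" "x c p \<le> x c q" "i = meet c q y" by blast
    then have "q = p \<or> x c p < x c q"
      using x_eq_iff[of p q c] assms by (fastforce simp: outgoing_def)
    then show "i \<in> {c<..meet c p y}"
      using meet_mono_outgoing[OF assms(1) q(1) assms(2-4)] meet(2)[OF q(1) assms(2-4)] q by auto
  qed
  finally show ?thesis using meet(2)[OF assms] by simp
qed

text \<open>After \<open>p\<close> has met \<open>y\<close>, the outgoing points inside \<open>p\<close> still have to meet \<open>y\<close>, one per move.\<close>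

lemma meet_upper:
  assumes "p \<in> outgoing c" "y \<in> incoming e" "c < e" "e < c + 2 * int n"
    and "\<And>q. q \<in> outgoing c \<Longrightarrow> meet c q y < b"
  shows "meet c p y + int (weight c) < b + int (rank c p)"
proof -
  let ?A = "{q \<in> outgoing c. x c q < x c p}"
  have "card ?A = card ((\<lambda>q. meet c q y) ` ?A)"
    using meet_inj_outgoing[OF assms(2-4)]
    by (intro card_image[symmetric]) (auto intro: inj_on_subset)
  also have "\<dots> \<le> card {meet c p y<..<b}"
    using meet_mono_outgoing[OF _ assms(1-4)] assms(5) by (intro card_mono) auto
  finally show ?thesis using assms(5)[OF assms(1)] rank_complement[of c p] by simp
qed

text \<open>Between two of its crossings, \<open>p\<close> is swapped with at most one point per move.\<close>

lemma meet_inj: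
  assumes "p \<in> outgoing c"
  shows "inj_on (meet c p) (\<Union>e\<in>{c<..<c + 2 * int n}. incoming e)"
proof (rule inj_onI)
  fix y z assume "y \<in> (\<Union>e\<in>{c<..<c + 2 * int n}. incoming e)" "z \<in> (\<Union>e\<in>{c<..<c + 2 * int n}. incoming e)"
    and eq: "meet c p y = meet c p z"
  then obtain e f where e: "y \<in> incoming e" "c < e" "e < c + 2 * int n"
    and f: "z \<in> incoming f" "c < f" "f < c + 2 * int n" by auto
  note oe = outgoing_before_incoming[OF assms e] and of = outgoing_before_incoming[OF assms f]
  note me = meet[OF assms e] and mf = meet[OF assms f]
  show "y = z"
    using swap_partner[OF oe(1,2) of(2), of "meet c p y"] oe(6) me mf eq e by auto
qed

section \<open>Distances between crossing moves\<close>

lemma ex_innermost: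
  assumes "0 < weight c" obtains p where "p \<in> outgoing c" "\<And>q. q \<in> outgoing c \<Longrightarrow> x c p \<le> x c q"
proof -
  have "outgoing c \<noteq> {}" using assms by (auto simp: weight_def)
  then show ?thesis
    using that arg_min_if_finite[OF finite_outgoing, of c "x c"] by (meson not_le)
qed

lemma ex_outermost:
  assumes "0 < weight c" obtains p where "p \<in> outgoing c" "\<And>q. q \<in> outgoing c \<Longrightarrow> x c q \<le> x c p"
proof -
  have "outgoing c \<noteq> {}" using assms by (auto simp: weight_def)
  then show ?thesis
    using that arg_min_if_finite[OF finite_outgoing, of c "\<lambda>p. - x c p"] by (meson neg_le_iff_le not_le)
qed

text \<open>The innermost outgoing point of move \<open>c\<close> needs \<open>weight e\<close> distinct moves before move \<open>e\<close> to meet the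
  incoming points of move \<open>e\<close>, and the first of these meetings has to wait for the other outgoing points.\<close>

lemma gap_lower:
  assumes "0 < weight c" "0 < weight e" "c < e" "e < c + 2 * int n"
  shows "int (weight c + weight e) \<le> e - c"
proof -
  obtain p where p: "p \<in> outgoing c" "\<And>q. q \<in> outgoing c \<Longrightarrow> x c p \<le> x c q"
    using ex_innermost assms(1) by blast
  have "{q \<in> outgoing c. x c p \<le> x c q} = outgoing c" using p by blast
  then have "rank c p = weight c" by (simp add: rank_def weight_def)
  then have *: "c + int (weight c) \<le> meet c p y" if "y \<in> incoming e" for y
    using meet_lower[OF p(1) that assms(3,4)] by simp
  have sub: "incoming e \<subseteq> (\<Union>e\<in>{c<..<c + 2 * int n}. incoming e)"
    using assms by (intro UN_upper) simp
  have "weight e = card (meet c p ` incoming e)"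
    using card_incoming card_image[OF inj_on_subset[OF meet_inj[OF p(1)] sub]] by simp
  also have "\<dots> \<le> card {c + int (weight c)..<e}"
    using * meet(3)[OF p(1) _ assms(3,4)] by (intro card_mono) auto
  finally have "weight e \<le> nat (e - (c + int (weight c)))" by simp
  then show ?thesis using assms(2) by linarith
qed

definition weight_between :: "int \<Rightarrow> int \<Rightarrow> nat" where
  "weight_between c e = (\<Sum>i\<in>{c<..<e}. weight i)"

lemma weight_between_split:
  assumes "c < f" "f < e"
  shows "weight_between c e = weight_between c f + weight f + weight_between f e"
proof -
  have "{c<..<e} = insert f ({c<..<f} \<union> {f<..<e})" using assms by auto
  then show ?thesis by (simp add: weight_between_def sum.union_disjoint)
qed

lemma weight_between_period:
  assumes "0 < n" shows "weight_between c (c + 2 * int n) + weight c = n"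
proof -
  have "{c<..c + 2 * int n} = insert (c + 2 * int n) {c<..<c + 2 * int n}" using assms by auto
  then show ?thesis using sum_weight[of c] weight_periodic[of c] by (simp add: weight_between_def)
qed

lemma crossing_distance_lower:
  assumes "0 < weight c" "0 < weight e" "c < e" "e < c + 2 * int n"
  shows "int (weight c + 2 * weight_between c e + weight e) \<le> e - c"
  using assms
proof (induction "nat (e - c)" arbitrary: c e rule: less_induct)
  case less
  show ?case
  proof (cases "\<exists>f. c < f \<and> f < e \<and> 0 < weight f")
    case True
    then obtain f where f: "c < f" "f < e" "0 < weight f" by blast
    have "int (weight c + 2 * weight_between c f + weight f) \<le> f - c"
      "int (weight f + 2 * weight_between f e + weight e) \<le> e - f"
      using less f by auto
    then show ?thesis using weight_between_split[OF f(1,2)] by simp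
  next
    case False
    then have "weight_between c e = 0" by (simp add: weight_between_def)
    then show ?thesis using gap_lower[of c e] less by simp
  qed
qed

text \<open>The lower bounds for the distance from \<open>c\<close> to \<open>e\<close> and from \<open>e\<close> to \<open>c + 2 * n\<close> add up to
  \<open>2 * n\<close>, because the weights in a halfperiod add up to \<open>n\<close>. Hence both bounds are attained.\<close>

lemma crossing_distance:
  assumes "0 < weight c" "0 < weight e" "c < e" "e < c + 2 * int n"
  shows "e - c = int (weight c + 2 * weight_between c e + weight e)"
proof -
  have "int (weight e + 2 * weight_between e (c + 2 * int n) + weight c) \<le> c + 2 * int n - e"
    using crossing_distance_lower[of e "c + 2 * int n"] assms weight_periodic[of c] by simp
  moreover have "weight_between c e + weight e + weight_between e (c + 2 * int n) + weight c = n"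
    using weight_between_period[of c] weight_between_split[OF assms(3,4)] assms by simp
  ultimately show ?thesis using crossing_distance_lower[OF assms] by linarith
qed

section \<open>The moves of an outgoing point\<close>

lemma weight_pos_outgoing: "p \<in> outgoing c \<Longrightarrow> 0 < weight c"
  using finite_outgoing[of c] by (auto simp: weight_def card_gt_0_iff)

lemma weight_pos_incoming: "y \<in> incoming c \<Longrightarrow> 0 < weight c"
  using finite_incoming[of c] card_incoming[of c] card_gt_0_iff[of "incoming c"] by auto

text \<open>If no crossing move lies between \<open>c\<close> and \<open>e\<close>, the bound is \<open>e\<close> itself. Otherwise let \<open>f\<close> be the first
  crossing move after \<open>c\<close> and \<open>z\<close> its outermost outgoing point. By induction, the meetings of \<open>z\<close> with the
  points incoming in the moves \<open>f + 1, \<dots>, e\<close> fill an initial run of moves after \<open>f\<close> without any hole, so \<open>z\<close>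
  cannot pass \<open>p\<close> during this run. When \<open>z\<close> meets \<open>y\<close>, \<open>p\<close> is therefore outside \<open>z\<close>, and \<open>y\<close>
  has met \<open>p\<close> strictly before.\<close>

lemma meet_bound:
  assumes "p \<in> outgoing c" "y \<in> incoming e" "c < e" "e < c + 2 * int n"
  shows "meet c p y < c + int (weight c + weight_between c e + weight e)"
  using assms
proof (induction "nat (e - c)" arbitrary: c e p y rule: less_induct)
  case less
  note weights = weight_pos_outgoing[OF less(2)] weight_pos_incoming[OF less(3)]
  note m = meet[OF less(2-5)] and o = outgoing_before_incoming[OF less(2-5)]
  show ?case
  proof (cases "\<exists>f. c < f \<and> f < e \<and> 0 < weight f")
    case False
    then have "weight_between c e = 0" by (simp add: weight_between_def)
    then show ?thesis using m(3) crossing_distance[OF weights less(4,5)] by simp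
  next
    case True
    \<comment> \<open>Crossing moves are indexed by integers, so the first one after \<open>c\<close> is found through its offset.\<close>
    let ?P = "\<lambda>m. c < c + int m \<and> 0 < weight (c + int m)"
    from True obtain f' where f': "c < f'" "f' < e" "0 < weight f'" by blast
    then have P: "?P (nat (f' - c))" by simp
    define f where "f = c + int (LEAST m. ?P m)"
    have f: "c < f" "0 < weight f" using LeastI[of ?P, OF P] by (simp_all add: f_def)
    have "f \<le> f'" using Least_le[of ?P, OF P] f' by (simp add: f_def)
    then have fe: "f < e" "f < c + 2 * int n" "e < f + 2 * int n" using f f' less by auto
    have "weight g = 0" if "c < g" "g < f" for g
      using not_less_Least[of "nat (g - c)" ?P] that by (auto simp: f_def)
    then have "weight_between c f = 0" by (simp add: weight_between_def)
    then have fc: "f = c + int (weight c + weight f)"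
      and between: "weight_between c e = weight f + weight_between f e"
      using crossing_distance[OF weights(1) f(2) f(1) fe(2)] weight_between_split[OF f(1) fe(1)] by auto
    obtain z where z: "z \<in> outgoing f" "\<And>q. q \<in> outgoing f \<Longrightarrow> x f q \<le> x f z"
      using ex_outermost f by blast
    have "{q \<in> outgoing f. x f z \<le> x f q} = {z}"
      using z x_eq_iff[of _ z f] by (force simp: outgoing_def)
    then have rank_z: "rank f z = 1" by (simp add: rank_def)
    define Y where "Y = (\<Union>l\<in>{f<..e}. incoming l)"
    have "{f<..e} = insert e {f<..<e}" using fe by auto
    then have cardY: "card Y = weight_between f e + weight e"
      unfolding Y_def using fe by (subst card_incoming_Union[of _ f]) (auto simp: weight_between_def)
    have range: "f < meet f z v \<and> meet f z v \<le> f + int (card Y)" if v: "v \<in> Y" for v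
    proof -
      obtain l where l: "f < l" "l \<le> e" "v \<in> incoming l" using v by (auto simp: Y_def)
      then have l': "l < f + 2 * int n" using fe by simp
      have "meet f q v < f + int (weight f + weight_between f l + weight l)" if "q \<in> outgoing f" for q
        using less(1)[OF _ that l(3) l(1) l'] l f by simp
      from meet_upper[OF z(1) l(3,1) l' this]
      have "meet f z v \<le> f + int (weight_between f l + weight l)" using rank_z by linarith
      moreover have "weight_between f l + weight l \<le> card Y"
        using weight_between_split[of f l e] l by (cases "l = e") (auto simp: cardY)
      ultimately show ?thesis using meet(2)[OF z(1) l(3,1) l'] by linarith
    qed
    \<comment> \<open>As many distinct meetings as there are moves in the run: every move is taken.\<close>
    have "inj_on (meet f z) Y"
      unfolding Y_def using fe by (intro inj_on_subset[OF meet_inj[OF z(1)]] UN_mono) auto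
    then have "card (meet f z ` Y) = card {f<..f + int (card Y)}" by (simp add: card_image)
    moreover have "meet f z ` Y \<subseteq> {f<..f + int (card Y)}" using range by auto
    ultimately have busy: "meet f z ` Y = {f<..f + int (card Y)}"
      by (intro card_subset_eq) auto
    have yY: "y \<in> Y" using less fe by (auto simp: Y_def)
    note oz = outgoing_before_incoming[OF z(1) less(3) fe(1,3)]
    note mz = meet[OF z(1) less(3) fe(1,3)]
    define t where "t = meet f z y"
    have no_swap: "\<not> swap x i z p" if i: "f < i" "i \<le> t" for i
    proof
      assume sw: "swap x i z p"
      have "i \<in> meet f z ` Y" using i range[OF yY] busy by (auto simp: t_def)
      then obtain v l where v: "v \<in> incoming l" "f < l" "l \<le> e" "i = meet f z v" 
        by (auto simp: Y_def)
      then have l: "l < f + 2 * int n" using fe by simp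
      note ov = outgoing_before_incoming[OF z(1) v(1,2) l]
      have "p = v" using swap_partner[OF ov(1) o(1) ov(2) ov(6) sw] meet[OF z(1) v(1,2) l] v l by auto
      then have "cross x l p" using v by (auto simp: incoming_def)
      then show False using o(6)[of l] v f less by simp
    qed
    have "0 < x f p" using cross_sign[OF o(1), of c f] less f fe by (auto simp: outgoing_def)
    then have "x f z < x f p" 
      using cross_innermost[OF oz(1) o(1), of f f] o(6)[of f] f fe z by (auto simp: outgoing_def)
    then have "x t z < x t p" 
      using order_change[of f t z p] no_swap mz by (auto simp: t_def)
    moreover have "x t y < x t z" using mz by (auto simp: t_def)
    ultimately have "x t y < x t p" by simp
    then have "meet c p y \<le> t"
      using meet_less[OF less(2-5), of t] mz f by (auto simp: t_def)
    \<comment> \<open>In move \<open>t\<close> the point \<open>y\<close> is busy with \<open>z\<close>, which makes the inequality strict.\<close>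
    moreover have "meet c p y \<noteq> t"
    proof
      assume "meet c p y = t"
      then have "swap x t y p" "swap x t y z" using m mz swap_sym o oz by (auto simp: t_def)
      moreover have "\<not> cross x t y" using o(7)[of t] mz f less by (auto simp: t_def)
      ultimately have "p = z" using swap_partner[of y p z] o oz by auto
      then show False using \<open>x f z < x f p\<close> by simp
    qed
    moreover have "t \<le> f + int (card Y)" using range[OF yY] by (simp add: t_def)
    ultimately show ?thesis using fc between cardY by simp
  qed
qed

text \<open>Both bounds together confine the \<open>n - weight c\<close> distinct meetings to a window of that length.\<close>

lemma meet_times:
  assumes "p \<in> outgoing c"
  shows "meet c p ` (\<Union>e\<in>{c<..<c + 2 * int n}. incoming e) = 
    {c + int (rank c p)..<c + int (rank c p) + int (n - weight c)}"
proof -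
  let ?E = "\<Union>e\<in>{c<..<c + 2 * int n}. incoming e"
  have n: "weight_between c (c + 2 * int n) + weight c = n"
    using weight_between_period n_pos assms by (auto simp: outgoing_def)
  then have card_E: "card ?E = n - weight c"
    by (subst card_incoming_Union[of _ c]) (auto simp: weight_between_def)
  have "meet c p ` ?E \<subseteq> {c + int (rank c p)..<c + int (rank c p) + int (n - weight c)}"
  proof (rule image_subsetI)
    fix y assume "y \<in> ?E"
    then obtain e where e: "y \<in> incoming e" "c < e" "e < c + 2 * int n" by auto
    have "meet c q y < c + int n" if "q \<in> outgoing c" for q
      using meet_bound[OF that e] weight_between_split[OF e(2,3)] n by linarith
    from meet_upper[OF assms e this] meet_lower[OF assms e]
    show "meet c p y \<in> {c + int (rank c p)..<c + int (rank c p) + int (n - weight c)}"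
      using n by auto
  qed
  moreover have "card (meet c p ` ?E) = n - weight c"
    using card_E meet_inj[OF assms] by (simp add: card_image)
  ultimately show ?thesis by (intro card_subset_eq) auto
qed

theorem outward_moves:
  assumes "p \<in> outgoing c" "c < i" "i < c + 2 * int n"
  shows "(\<exists>y\<in>S. swap x i p y \<and> x (i - 1) p < x (i - 1) y) \<longleftrightarrow>
    c + int (rank c p) \<le> i \<and> i < c + int (rank c p) + int (n - weight c)"
    (is "?lhs \<longleftrightarrow> ?rhs")
proof
  assume ?rhs
  then have "i \<in> meet c p ` (\<Union>e\<in>{c<..<c + 2 * int n}. incoming e)" using meet_times[OF assms(1)] by auto
  then obtain y e where e: "y \<in> incoming e" "c < e" "e < c + 2 * int n" and i: "i = meet c p y" by auto
  show ?lhs using meet[OF assms(1) e] outgoing_before_incoming[OF assms(1) e] i by fastforce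
next
  assume ?lhs
  then obtain y where y: "y \<in> S" "swap x i p y" "x (i - 1) p < x (i - 1) y" by blast
  have p: "p \<in> S" "cross x c p" "0 < x c p" using assms by (auto simp: outgoing_def)
  have "x c p < x c y"
  proof (rule ccontr)
    assume "\<not> x c p < x c y"
    then obtain j where "c < j" "j \<le> i - 1" "swap x j p y"
      using order_change[of c "i - 1" p y] assms y by auto
    then show False using swap_unique[OF p(1) y(1) _ y(2), of j] assms by auto
  qed
  have not_c: "\<not> cross x c y"
    using cross_swap[OF p(1) y(1) swap_neq[OF y(2)] p(2)] swap_unique[OF p(1) y(1) _ y(2), of c] assms by auto
  obtain e where e: "c < e" "e \<le> c + 2 * int n" "cross x e y" using cross_exists[OF y(1)] by blast
  have e': "e < c + 2 * int n"
    using e not_c cross_periodic[OF y(1), of c] by (cases "e = c + 2 * int n") auto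
  have "y \<in> incoming e"
    using cross_sign_before[OF y(1) e(3), of c] e e' p \<open>x c p < x c y\<close> y by (auto simp: incoming_def)
  moreover have "meet c p y = i" using meet_eq[OF p(1) y(1) assms(2) _ y(2)] assms by simp
  ultimately have "i \<in> meet c p ` (\<Union>e\<in>{c<..<c + 2 * int n}. incoming e)" using e e' by force
  then show ?rhs using meet_times[OF assms(1)] by auto
qed

text \<open>Reversing time about the middle of a halfperiod turns move \<open>i\<close> into move \<open>2 * n + 1 - i\<close>, which maps the
  window of \<open>swap_once\<close> to itself.\<close>

lemma time_reversal: "central_motion S n (\<lambda>i. x (2 * int n - i)) bar"
proof -
  let ?y = "\<lambda>i. x (2 * int n - i)"
  have sw: "swap ?y i p q \<longleftrightarrow> swap x (2 * int n + 1 - i) p q" for i p q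
    unfolding swap_def by (auto simp: algebra_simps)
  have cr: "cross ?y i p \<longleftrightarrow> cross x (2 * int n + 1 - i) p" for i p
    unfolding cross_def by (auto simp: algebra_simps)
  show ?thesis
  proof
    show "?y (i + 2 * int n) p = - ?y i p" if "p \<in> S" for i p
      using x_antiperiodic[OF that, of "- i"] by (simp add: algebra_simps)
    show "\<exists>!i. i \<in> {1..2 * int n} \<and> swap ?y i p q" if pq: "p \<in> S" "q \<in> S" "p \<noteq> q" for p q
    proof -
      obtain i where i: "i \<in> {1..2 * int n}" "swap x i p q" 
        "\<And>j. j \<in> {1..2 * int n} \<Longrightarrow> swap x j p q \<Longrightarrow> j = i" using swap_once[OF pq] by blast
      show ?thesis unfolding sw
      proof (intro ex1I[of _ "2 * int n + 1 - i"])
        show "j = 2 * int n + 1 - i" if "j \<in> {1..2 * int n} \<and> swap x (2 * int n + 1 - j) p q" for j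
          using i(3)[of "2 * int n + 1 - j"] that by auto
      qed (use i(1,2) in auto)
    qed
    show "q = r" if "p \<in> S" "q \<in> S" "r \<in> S" "\<not> cross ?y i p" "swap ?y i p q" "swap ?y i p r" for i p q r
      using that unfolding sw cr by (rule swap_partner)
    show "swap ?y i p q" if "p \<in> S" "q \<in> S" "p \<noteq> q" "cross ?y i p" "cross ?y i q" for i p q
      using that unfolding sw cr by (rule cross_swap)
    show "cross ?y i q" if "p \<in> S" "q \<in> S" "cross ?y i p" "swap ?y i p q" for i p q
      using that unfolding sw cr by (rule swap_cross)
  qed (simp_all add: finite_S card_S bar_in inj_x x_bar x_nonzero)
qed

text \<open>Run backwards, \<open>p\<close> enters the right half in move \<open>1 - c\<close>, which is move \<open>c + 2 * n\<close> of the original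
  motion. The points entering with it are again those that are outgoing at \<open>c\<close>, with the same ranks, because
  the positions just before move \<open>c + 2 * n\<close> are the negatives of those just before move \<open>c\<close>, and crossing
  reverses the order.\<close>

theorem inward_moves:
  assumes "p \<in> outgoing c" "c < i" "i < c + 2 * int n"
  shows "(\<exists>y\<in>S. swap x i p y \<and> x i p < x i y) \<longleftrightarrow>
    c + 2 * int n - int (rank c p) - int (n - weight c) < i \<and> i \<le> c + 2 * int n - int (rank c p)"
proof -
  let ?y = "\<lambda>i. x (2 * int n - i)"
  interpret rev: central_motion S n ?y bar by (rule time_reversal)
  have sw: "swap ?y i p q \<longleftrightarrow> swap x (2 * int n + 1 - i) p q" for i p q
    unfolding swap_def by (auto simp: algebra_simps)
  have cr: "cross ?y i p \<longleftrightarrow> cross x (2 * int n + 1 - i) p" for i p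
    unfolding cross_def by (auto simp: algebra_simps)
  have per: "q \<in> S \<Longrightarrow> cross x (2 * int n + c) q \<longleftrightarrow> cross x c q" for q
    using cross_periodic[of q c] by (simp add: add.commute)
  have out: "rev.outgoing (1 - c) = outgoing c"
  proof -
    have "x (2 * int n - (1 - c)) q = - x (c - 1) q" if "q \<in> S" for q
      using x_antiperiodic[OF that, of "c - 1"] by (simp add: algebra_simps)
    moreover have "x (c - 1) q < 0 \<longleftrightarrow> 0 < x c q" if "q \<in> S" "cross x c q" for q
      using that x_nonzero[of q c] by (auto simp: cross_def)
    ultimately show ?thesis by (auto simp: rev.outgoing_def outgoing_def cr per)
  qed
  have w: "rev.weight (1 - c) = weight c" by (simp add: rev.weight_def weight_def out)
  have r: "rev.rank (1 - c) p = rank c p"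
  proof -
    have "x (2 * int n - (1 - c)) p \<le> x (2 * int n - (1 - c)) q \<longleftrightarrow> x c p \<le> x c q"
      if q: "q \<in> outgoing c" for q
      using cross_reverses[of q p c] x_antiperiodic[of q "c - 1"] x_antiperiodic[of p "c - 1"] q assms
      by (simp add: outgoing_def algebra_simps)
    then show ?thesis unfolding rev.rank_def rank_def out by (auto intro: arg_cong[where f = card])
  qed
  show ?thesis
    using rev.outward_moves[of p "1 - c" "2 * int n + 1 - i"] assms out w r
    by (auto simp: sw)
qed

end

section \<open>Positions in permutations\<close>

lemma pos_nth: "distinct xs \<Longrightarrow> j < length xs \<Longrightarrow> pos xs (xs ! j) = Suc j"
  unfolding pos_def by (auto simp: nth_eq_iff_index_eq intro: Least_equality)

lemma pos_bounds:
  assumes "distinct xs" "p \<in> set xs" shows "1 \<le> pos xs p" "pos xs p \<le> length xs"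
proof -
  obtain j where "j < length xs" "xs ! j = p" using assms(2) by (auto simp: in_set_conv_nth)
  then show "1 \<le> pos xs p" "pos xs p \<le> length xs" using pos_nth[OF assms(1), of j] by simp_all
qed

lemma pos_eq_iff: "distinct xs \<Longrightarrow> p \<in> set xs \<Longrightarrow> q \<in> set xs \<Longrightarrow> pos xs p = pos xs q \<longleftrightarrow> p = q"
  by (metis in_set_conv_nth nat.inject pos_nth)

lemma pos_rev:
  assumes "distinct xs" "p \<in> set xs" shows "pos (rev xs) p + pos xs p = Suc (length xs)"
proof -
  obtain j where j: "j < length xs" "xs ! j = p" using assms by (auto simp: in_set_conv_nth)
  then have "rev xs ! (length xs - Suc j) = p" by (simp add: rev_nth)
  then show ?thesis using pos_nth[of xs j] pos_nth[of "rev xs" "length xs - Suc j"] assms j by auto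
qed

lemma pos_append:
  assumes "distinct (u @ v)"
  shows "p \<in> set u \<Longrightarrow> pos (u @ v) p = pos u p"
    and "p \<in> set v \<Longrightarrow> pos (u @ v) p = length u + pos v p"
proof -
  assume "p \<in> set u"
  then obtain j where "j < length u" "u ! j = p" by (auto simp: in_set_conv_nth)
  then show "pos (u @ v) p = pos u p"
    using pos_nth[of u j] pos_nth[of "u @ v" j] assms by (simp add: nth_append)
next
  assume "p \<in> set v"
  then obtain j where "j < length v" "v ! j = p" by (auto simp: in_set_conv_nth)
  then show "pos (u @ v) p = length u + pos v p"
    using pos_nth[of v j] pos_nth[of "u @ v" "length u + j"] assms by (simp add: nth_append)
qed

lemma in_infix_iff_pos:
  assumes "distinct (u @ s @ v)" "p \<in> set (u @ s @ v)"
  shows "p \<in> set s \<longleftrightarrow> length u < pos (u @ s @ v) p \<and> pos (u @ s @ v) p \<le> length u + length s"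
proof -
  have d: "distinct (s @ v)" "distinct u" "distinct s" "distinct v" using assms by auto
  consider "p \<in> set u" "p \<notin> set s" | "p \<in> set s" | "p \<in> set v" "p \<notin> set s" using assms by auto
  then show ?thesis
  proof cases
    case 1
    then show ?thesis using pos_append(1)[OF assms(1)] pos_bounds[OF d(2)] by fastforce
  next
    case 2
    then show ?thesis
      using pos_append(2)[OF assms(1)] pos_append(1)[OF d(1)] pos_bounds[OF d(3)] by fastforce
  next
    case 3
    then show ?thesis
      using pos_append(2)[OF assms(1)] pos_append(2)[OF d(1)] pos_bounds[OF d(4)] by fastforce
  qed
qed

lemma distinct_concat_map_rev: "distinct (concat (map rev B)) = distinct (concat B)"
  by (induction B) auto

lemma length_concat_map_rev: "length (concat (map rev B)) = length (concat B)"
  by (induction B) auto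

lemma order_after_reversals:
  assumes "distinct (concat B)" "p \<in> set (concat B)" "q \<in> set (concat B)" "p \<noteq> q"
  shows "pos (concat (map rev B)) p < pos (concat (map rev B)) q \<longleftrightarrow>
    (if \<exists>s\<in>set B. p \<in> set s \<and> q \<in> set s then pos (concat B) q < pos (concat B) p
     else pos (concat B) p < pos (concat B) q)"
  using assms
proof (induction B)
  case (Cons b B)
  let ?B = "concat B" and ?R = "concat (map rev B)"
  have d: "distinct b" "distinct ?B" "set b \<inter> set ?B = {}" "distinct (b @ ?B)"
    using Cons.prems by auto
  have dR: "distinct (rev b @ ?R)" "distinct ?R" "set ?R = set ?B"
    using d distinct_concat_map_rev[of B] by auto
  have blk: "\<not> r \<in> set ?B" if "r \<in> set b" for r using that d by blast
  note pb = pos_append[OF d(4)] and pR = pos_append[OF dR(1)]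
  consider "p \<in> set b" "q \<in> set b" | "p \<in> set b" "q \<in> set ?B" | "p \<in> set ?B" "q \<in> set b"
    | "p \<in> set ?B" "q \<in> set ?B" using Cons.prems by auto
  then show ?case
  proof cases
    case 1
    then show ?thesis using pb(1) pR(1) pos_rev[OF d(1), of p] pos_rev[OF d(1), of q] by auto
  next
    case 2
    then have ex: "\<not> (\<exists>s\<in>set (b # B). p \<in> set s \<and> q \<in> set s)" using d(3) by auto
    have "pos (rev b) p \<le> length b" "1 \<le> pos ?R q" "pos b p \<le> length b" "1 \<le> pos ?B q"
      using 2 d dR pos_bounds[of "rev b" p] pos_bounds[of b p] pos_bounds[of ?R q] pos_bounds[of ?B q]
      by auto
    then show ?thesis unfolding if_not_P[OF ex] using 2 pb(1)[of p] pb(2)[of q] pR(1)[of p] pR(2)[of q] by simp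
  next
    case 3
    then have ex: "\<not> (\<exists>s\<in>set (b # B). p \<in> set s \<and> q \<in> set s)" using d(3) by auto
    have "pos (rev b) q \<le> length b" "1 \<le> pos ?R p" "pos b q \<le> length b" "1 \<le> pos ?B p"
      using 3 d dR pos_bounds[of "rev b" q] pos_bounds[of b q] pos_bounds[of ?R p] pos_bounds[of ?B p]
      by auto
    then show ?thesis unfolding if_not_P[OF ex] using 3 pb(1)[of q] pb(2)[of p] pR(1)[of q] pR(2)[of p] by simp
  next
    case 4
    then have ex: "(\<exists>s\<in>set (b # B). p \<in> set s \<and> q \<in> set s) \<longleftrightarrow> (\<exists>s\<in>set B. p \<in> set s \<and> q \<in> set s)"
      using d(3) by auto
    show ?thesis unfolding ex
      using 4 pb(2)[of p] pb(2)[of q] pR(2)[of p] pR(2)[of q] dR(3)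
      by (auto simp: Cons.IH[OF d(2) 4 Cons.prems(4)] simp del: set_concat)
  qed
qed simp

lemma block_eq:
  "distinct (concat B) \<Longrightarrow> s \<in> set B \<Longrightarrow> s' \<in> set B \<Longrightarrow> p \<in> set s \<Longrightarrow> p \<in> set s' \<Longrightarrow> s = s'"
  by (auto simp: distinct_concat_iff)

section \<open>Symmetric allowable sequences as motions\<close>

locale symmetric_sequence = allowable_sequence S \<pi> h for S :: "'a set" and \<pi> h +
  fixes n :: nat
  assumes card_points: "card S = 2 * n" and halfperiod_eq: "h = 2 * n"
    and symmetric: "centrally_symmetric S \<pi>"
    and general_position: "noncentral_general_position \<pi>"
begin

abbreviation bar :: "'a \<Rightarrow> 'a" where "bar \<equiv> conjugate_point S \<pi>"

text \<open>Positions are doubled to keep the center, which lies between positions \<open>n\<close> and \<open>n + 1\<close>, integral.\<close>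

definition centered_pos :: "int \<Rightarrow> 'a \<Rightarrow> int" where
  "centered_pos i p = 2 * int (pos (\<pi> i) p) - (2 * int n + 1)"

definition blocks :: "int \<Rightarrow> 'a list list" where
  "blocks i = (SOME B. move B (\<pi> (i - 1)) (\<pi> i))"

lemma move_blocks: "move (blocks i) (\<pi> (i - 1)) (\<pi> i)"
  unfolding blocks_def using moves[of i] by (rule someI_ex)

lemma concat_blocks: "concat (blocks i) = \<pi> (i - 1)" "concat (map rev (blocks i)) = \<pi> i"
  using move_blocks[of i] by (simp_all add: move_def)

lemma switches_eq: "switches (\<pi> (i - 1)) (\<pi> i) = {s \<in> set (blocks i). 2 \<le> length s}"
  unfolding switches_def using move_blocks[of i] move_blocks_unique[OF permutation(1) move_blocks[of i]]
  by blast

lemma length_permutation: "length (\<pi> i) = 2 * n"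
  using distinct_card[OF permutation(1)[of i]] permutation(2) card_points by simp

lemma bar: assumes "p \<in> S" shows "bar p \<in> S" "pos (\<pi> i) p + pos (\<pi> i) (bar p) = 2 * n + 1"
proof -
  obtain q where q: "is_conjugate S \<pi> p q" using symmetric assms by (auto simp: centrally_symmetric_def)
  have "r = q" if "is_conjugate S \<pi> p r" for r
  proof -
    have "pos (\<pi> 0) r = pos (\<pi> 0) q" "r \<in> S" "q \<in> S"
      using q that unfolding is_conjugate_def by (metis add_left_cancel)+
    then show ?thesis using pos_eq_iff[OF permutation(1)] permutation(2) by blast
  qed
  with q have "bar p = q" unfolding conjugate_point_def by (intro the_equality)
  then show "bar p \<in> S" "pos (\<pi> i) p + pos (\<pi> i) (bar p) = 2 * n + 1"
    using q card_points by (auto simp: is_conjugate_def)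
qed

lemma conjugate_neq: assumes "p \<in> S" shows "bar p \<noteq> p"
proof
  assume "bar p = p"
  then have "2 * pos (\<pi> 0) p = 2 * n + 1" using bar(2)[OF assms, of 0] by simp
  then show False by presburger
qed

lemma centered_pos_less: "centered_pos i p < centered_pos i q \<longleftrightarrow> pos (\<pi> i) p < pos (\<pi> i) q"
  by (simp add: centered_pos_def)

lemma centered_pos_bar: "p \<in> S \<Longrightarrow> centered_pos i (bar p) = - centered_pos i p"
  using bar(2)[of p i] by (simp add: centered_pos_def)

lemma swap_iff_block:
  assumes "p \<in> S" "q \<in> S"
  shows "swap centered_pos i p q \<longleftrightarrow> p \<noteq> q \<and> (\<exists>s\<in>set (blocks i). p \<in> set s \<and> q \<in> set s)"
proof (cases "p = q")
  case False
  have "pos (\<pi> (i - 1)) p \<noteq> pos (\<pi> (i - 1)) q"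
    using pos_eq_iff[OF permutation(1)] permutation(2) assms False by blast
  then show ?thesis
    using order_after_reversals[of "blocks i" p q] assms False permutation[of "i - 1"]
    by (auto simp: swap_def centered_pos_less concat_blocks)
qed (simp add: swap_def)

lemma swap_iff_switch:
  assumes "p \<in> S" "q \<in> S" "p \<noteq> q"
  shows "swap centered_pos i p q \<longleftrightarrow> (\<exists>s\<in>switches (\<pi> (i - 1)) (\<pi> i). p \<in> set s \<and> q \<in> set s)"
proof -
  have "2 \<le> length s" if "p \<in> set s" "q \<in> set s" for s
  proof -
    have "card {p, q} \<le> card (set s)" using that by (intro card_mono) auto
    then show ?thesis using card_length[of s] assms by simp
  qed
  then show ?thesis using swap_iff_block[OF assms(1,2)] assms(3) by (auto simp: switches_eq)
qed

lemma swap_bar_bar: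
  assumes "p \<in> S" "q \<in> S" shows "swap centered_pos i p q \<longleftrightarrow> swap centered_pos i (bar p) (bar q)"
proof -
  have "centered_pos j p = centered_pos j q \<longleftrightarrow> p = q" for j
    using pos_eq_iff[OF permutation(1)] permutation(2) assms by (auto simp: centered_pos_def)
  from this[of i] this[of "i - 1"] show ?thesis
    using assms by (cases "p = q") (auto simp: swap_def centered_pos_bar)
qed

lemma crossing_switch_centered:
  assumes "crossing_switch (\<pi> (i - 1)) (\<pi> i) s"
  shows "\<exists>m<n. \<forall>p\<in>S. p \<in> set s \<longleftrightarrow> m < pos (\<pi> (i - 1)) p \<and> pos (\<pi> (i - 1)) p \<le> 2 * n - m"
proof -
  from assms obtain u v where uv: "\<pi> (i - 1) = u @ s @ v" "length u = length v"
    and s: "2 \<le> length s" by (auto simp: crossing_switch_def switches_def)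
  have "length s + 2 * length u = 2 * n" using length_permutation[of "i - 1"] uv by simp
  then show ?thesis
    using s permutation[of "i - 1"] in_infix_iff_pos[of u s v] uv by (intro exI[of _ "length u"]) auto
qed

lemma bar_in_crossing_switch:
  assumes "crossing_switch (\<pi> (i - 1)) (\<pi> i) s" "p \<in> set s" "p \<in> S"
  shows "bar p \<in> set s"
proof -
  obtain m where m: "m < n" "\<And>p. p \<in> S \<Longrightarrow> p \<in> set s \<longleftrightarrow> 
    m < pos (\<pi> (i - 1)) p \<and> pos (\<pi> (i - 1)) p \<le> 2 * n - m"
    using crossing_switch_centered[OF assms(1)] by blast
  show ?thesis using m(2)[OF assms(3)] m(2)[OF bar(1)[OF assms(3)]] bar(2)[OF assms(3), of "i - 1"]
    m(1) assms(2) by auto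
qed

text \<open>A centered substring of at least two points contains the point at position \<open>n\<close>, and blocks are disjoint.\<close>

lemma crossing_switch_unique:
  assumes "crossing_switch (\<pi> (i - 1)) (\<pi> i) s" "crossing_switch (\<pi> (i - 1)) (\<pi> i) s'"
  shows "s = s'"
proof -
  let ?p = "\<pi> (i - 1) ! (n - 1)"
  obtain m where m: "m < n" "\<And>p. p \<in> S \<Longrightarrow> p \<in> set s \<longleftrightarrow> 
    m < pos (\<pi> (i - 1)) p \<and> pos (\<pi> (i - 1)) p \<le> 2 * n - m"
    using crossing_switch_centered[OF assms(1)] by blast
  obtain m' where m': "m' < n" "\<And>p. p \<in> S \<Longrightarrow> p \<in> set s' \<longleftrightarrow> 
    m' < pos (\<pi> (i - 1)) p \<and> pos (\<pi> (i - 1)) p \<le> 2 * n - m'"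
    using crossing_switch_centered[OF assms(2)] by blast
  have "?p \<in> S" using nth_mem[of "n - 1" "\<pi> (i - 1)"] length_permutation[of "i - 1"] permutation(2) m by auto
  moreover have "pos (\<pi> (i - 1)) ?p = n"
    using pos_nth[OF permutation(1), of "n - 1" "i - 1"] length_permutation[of "i - 1"] m by simp
  ultimately have "?p \<in> set s" "?p \<in> set s'" using m m' by auto
  moreover have "s \<in> set (blocks i)" "s' \<in> set (blocks i)"
    using assms by (auto simp: crossing_switch_def switches_eq)
  ultimately show ?thesis
    using block_eq[of "blocks i" s s' ?p] permutation(1)[of "i - 1"] by (simp add: concat_blocks)
qed

text \<open>Conjugation preserves swaps, hence maps the block to a block; as the block contains \<open>p\<close> and its conjugate,
  it is mapped to itself. So the conjugates of its end points lie in it, which forces it to be centered.\<close>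

lemma crossing_switch_if_bar:
  assumes s: "s \<in> set (blocks i)" and p: "p \<in> set s" "bar p \<in> set s" "p \<in> S"
  shows "crossing_switch (\<pi> (i - 1)) (\<pi> i) s"
proof -
  have in_S: "q \<in> S" if "q \<in> set s" for q
    using that s permutation(2)[of "i - 1"] by (auto simp flip: concat_blocks(1))
  have dist: "distinct (concat (blocks i))" using permutation(1)[of "i - 1"] by (simp add: concat_blocks)
  have closed: "bar q \<in> set s" if q: "q \<in> set s" for q
  proof (cases "q = p")
    case False
    then have "swap centered_pos i p q" using swap_iff_block[of p q i] in_S s p q by blast
    then have "swap centered_pos i (bar p) (bar q)" using swap_bar_bar[of p q i] in_S p q by blast
    then obtain s' where "s' \<in> set (blocks i)" "bar p \<in> set s'" "bar q \<in> set s'"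
      using swap_iff_block[of "bar p" "bar q" i] bar(1) in_S p q by blast
    then show ?thesis using block_eq[OF dist s, of s' "bar p"] p by blast
  qed (use p in simp)
  obtain B B' where B: "blocks i = B @ s # B'" using s by (meson split_list)
  let ?u = "concat B" and ?v = "concat B'"
  have eq: "\<pi> (i - 1) = ?u @ s @ ?v" using concat_blocks(1)[of i] B by simp
  have iff: "q \<in> set s \<longleftrightarrow> length ?u < pos (\<pi> (i - 1)) q \<and> pos (\<pi> (i - 1)) q \<le> length ?u + length s"
    if "q \<in> S" for q
    using in_infix_iff_pos[of ?u s ?v q] that permutation[of "i - 1"] unfolding eq by blast
  have ne: "0 < length s" using p by auto
  have pn: "pos (\<pi> (i - 1)) (s ! j) = Suc (length ?u + j)" if "j < length s" for j
    using pos_nth[OF permutation(1), of "length ?u + j" "i - 1"] that by (simp add: eq nth_append)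
  have "bar (s ! 0) \<in> set s" "bar (s ! (length s - 1)) \<in> set s" using closed ne by simp_all
  moreover have "s ! 0 \<in> S" "s ! (length s - 1) \<in> S" using in_S ne by simp_all
  ultimately have "length ?u + length s = 2 * n - length ?u" "length ?u \<le> n"
    using bar(2)[of "s ! 0" "i - 1"] bar(2)[of "s ! (length s - 1)" "i - 1"]
      iff[of "bar (s ! 0)"] iff[of "bar (s ! (length s - 1))"] bar(1) pn[of 0] pn[of "length s - 1"] ne
    by auto
  then have "length ?u = length ?v" using length_permutation[of "i - 1"] eq by simp
  moreover have "2 \<le> length s"
  proof -
    have "card {p, bar p} = 2" using conjugate_neq[OF p(3)] by simp
    moreover have "card {p, bar p} \<le> card (set s)" using p by (intro card_mono) auto
    ultimately show ?thesis using card_length[of s] by linarith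
  qed
  ultimately show ?thesis using s eq unfolding crossing_switch_def switches_eq by blast
qed

lemma cross_iff:
  assumes "p \<in> S"
  shows "cross centered_pos i p \<longleftrightarrow> (\<exists>s. crossing_switch (\<pi> (i - 1)) (\<pi> i) s \<and> p \<in> set s)"
proof -
  have "cross centered_pos i p \<longleftrightarrow> swap centered_pos i p (bar p)"
    using centered_pos_bar[OF assms] by (simp add: cross_def swap_def)
  also have "\<dots> \<longleftrightarrow> (\<exists>s\<in>set (blocks i). p \<in> set s \<and> bar p \<in> set s)"
    using swap_iff_block[OF assms bar(1)[OF assms], of i] conjugate_neq[OF assms] by auto
  also have "\<dots> \<longleftrightarrow> (\<exists>s. crossing_switch (\<pi> (i - 1)) (\<pi> i) s \<and> p \<in> set s)"
  proof
    assume "\<exists>s\<in>set (blocks i). p \<in> set s \<and> bar p \<in> set s"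
    then show "\<exists>s. crossing_switch (\<pi> (i - 1)) (\<pi> i) s \<and> p \<in> set s"
      using crossing_switch_if_bar assms by blast
  next
    assume "\<exists>s. crossing_switch (\<pi> (i - 1)) (\<pi> i) s \<and> p \<in> set s"
    then obtain s where s: "crossing_switch (\<pi> (i - 1)) (\<pi> i) s" "p \<in> set s" by blast
    then have "s \<in> set (blocks i)" by (simp add: crossing_switch_def switches_eq)
    then show "\<exists>s\<in>set (blocks i). p \<in> set s \<and> bar p \<in> set s"
      using bar_in_crossing_switch[OF s assms] s by blast
  qed
  finally show ?thesis .
qed

text \<open>In noncentral general position such a swap is a transposition of neighbors.\<close>

lemma noncrossing_swap:
  assumes "p \<in> S" "q \<in> S" "\<not> cross centered_pos i p" "swap centered_pos i p q"
  obtains u v u' v' a b where "\<pi> (i - 1) = u @ [a, b] @ v" "\<pi> i = u' @ [b, a] @ v'"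
    "length u' = length u" "{a, b} = {p, q}" "[a, b] \<in> set (blocks i)"
proof -
  have ne: "p \<noteq> q" using assms by (auto simp: swap_def)
  obtain s where s: "s \<in> switches (\<pi> (i - 1)) (\<pi> i)" "p \<in> set s" "q \<in> set s"
    using swap_iff_switch[OF assms(1,2) ne] assms(4) by blast
  then have "length s = 2"
    using general_position cross_iff[OF assms(1)] assms(3)
    unfolding noncentral_general_position_def by blast
  then obtain a b where ab: "s = [a, b]" by (auto simp: length_Suc_conv numeral_2_eq_2)
  have blk: "s \<in> set (blocks i)" using s by (simp add: switches_eq)
  then obtain B B' where B: "blocks i = B @ s # B'" by (meson split_list)
  show ?thesis
  proof (rule that)
    show "\<pi> (i - 1) = concat B @ [a, b] @ concat B'" using concat_blocks(1)[of i] B ab by simp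
    show "\<pi> i = concat (map rev B) @ [b, a] @ concat (map rev B')"
      using concat_blocks(2)[of i] B ab by simp
    show "{a, b} = {p, q}" using s ab ne by auto
    show "[a, b] \<in> set (blocks i)" using blk ab by simp
  qed (rule length_concat_map_rev)
qed

lemma noncrossing_swap_pos:
  assumes "p \<in> S" "q \<in> S" "\<not> cross centered_pos i p" "swap centered_pos i p q"
  shows "pos (\<pi> (i - 1)) p < pos (\<pi> i) p \<longleftrightarrow> pos (\<pi> (i - 1)) p < pos (\<pi> (i - 1)) q"
    and "pos (\<pi> (i - 1)) p \<noteq> pos (\<pi> i) p"
proof -
  obtain u v u' v' a b where *: "\<pi> (i - 1) = u @ [a, b] @ v" "\<pi> i = u' @ [b, a] @ v'"
    "length u' = length u" "{a, b} = {p, q}" by (rule noncrossing_swap[OF assms])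
  have ne: "p \<noteq> q" using assms by (auto simp: swap_def)
  have "pos (\<pi> (i - 1)) a = Suc (length u)" "pos (\<pi> (i - 1)) b = Suc (Suc (length u))"
    using pos_nth[OF permutation(1)[of "i - 1"], of "length u"]
      pos_nth[OF permutation(1)[of "i - 1"], of "Suc (length u)"] * by (simp_all add: nth_append)
  moreover have "pos (\<pi> i) b = Suc (length u)" "pos (\<pi> i) a = Suc (Suc (length u))"
    using pos_nth[OF permutation(1)[of i], of "length u"]
      pos_nth[OF permutation(1)[of i], of "Suc (length u)"] * by (simp_all add: nth_append)
  moreover have "a = p \<and> b = q \<or> a = q \<and> b = p" using * ne by (auto simp: doubleton_eq_iff)
  ultimately show "pos (\<pi> (i - 1)) p < pos (\<pi> i) p \<longleftrightarrow> pos (\<pi> (i - 1)) p < pos (\<pi> (i - 1)) q"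
    and "pos (\<pi> (i - 1)) p \<noteq> pos (\<pi> i) p" by auto
qed

sublocale central_motion S n centered_pos bar
proof
  show "finite S" "card S = 2 * n" by (rule finite_points card_points)+
  show "bar p \<in> S" if "p \<in> S" for p using that by (rule bar)
  show "inj_on (centered_pos i) S" for i
    using pos_eq_iff[OF permutation(1)] permutation(2) by (auto simp: inj_on_def centered_pos_def)
  show "centered_pos i (bar p) = - centered_pos i p" if "p \<in> S" for i p
    using that by (rule centered_pos_bar)
  show "centered_pos i p \<noteq> 0" for i p unfolding centered_pos_def by presburger
  show "centered_pos (i + 2 * int n) p = - centered_pos i p" if "p \<in> S" for i p
    using pos_rev[OF permutation(1), of p i] permutation(2) reversal[of i] that length_permutation[of i]
    by (simp add: centered_pos_def halfperiod_eq)
  show "\<exists>!i. i \<in> {1..2 * int n} \<and> swap centered_pos i p q" if "p \<in> S" "q \<in> S" "p \<noteq> q" for p q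
    using switch_once[OF that] swap_iff_switch[OF that] by (simp add: halfperiod_eq)
  fix p q i assume p: "p \<in> S" and q: "q \<in> S"
  have blk: "s \<in> set (blocks i)" if "crossing_switch (\<pi> (i - 1)) (\<pi> i) s" for s
    using that by (simp add: crossing_switch_def switches_eq)
  show "swap centered_pos i p q"
    if "p \<noteq> q" "cross centered_pos i p" "cross centered_pos i q"
  proof -
    obtain s s' where "crossing_switch (\<pi> (i - 1)) (\<pi> i) s" "p \<in> set s"
      "crossing_switch (\<pi> (i - 1)) (\<pi> i) s'" "q \<in> set s'" using \<open>cross centered_pos i p\<close> \<open>cross centered_pos i q\<close> cross_iff p q by blast
    then show ?thesis using crossing_switch_unique blk swap_iff_block[OF p q] \<open>p \<noteq> q\<close> by blast
  qed
  show "cross centered_pos i q" if sw: "cross centered_pos i p" "swap centered_pos i p q"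
  proof -
    obtain s where s: "crossing_switch (\<pi> (i - 1)) (\<pi> i) s" "p \<in> set s" using sw cross_iff p by blast
    obtain s' where s': "s' \<in> set (blocks i)" "p \<in> set s'" "q \<in> set s'" using sw swap_iff_block p q by blast
    have "s = s'" using block_eq[of "blocks i" s s' p] blk s s' permutation(1)[of "i - 1"]
      by (simp add: concat_blocks)
    then show ?thesis using s s' cross_iff q by blast
  qed
  fix r assume r: "r \<in> S"
  show "q = r" if nc: "\<not> cross centered_pos i p" "swap centered_pos i p q" "swap centered_pos i p r"
  proof -
    obtain a b where ab: "{a, b} = {p, q}" "[a, b] \<in> set (blocks i)"
      using noncrossing_swap[OF p q nc(1,2)] by metis
    obtain s where s: "s \<in> set (blocks i)" "p \<in> set s" "r \<in> set s" using swap_iff_block[OF p r] nc by blast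
    have "p \<in> set [a, b]" using ab by auto
    then have "s = [a, b]" using block_eq[of "blocks i" s "[a, b]" p] ab s permutation(1)[of "i - 1"]
      by (simp add: concat_blocks)
    then have "r \<in> {p, q}" using s ab by auto
    then show ?thesis using nc by (auto simp: swap_def)
  qed
qed

text \<open>A point that moves to the right by a transposition is to the left of its partner before the move, one
  that moves to the left is so after the move.\<close>

lemma path_step_eq:
  assumes "p \<in> S"
  shows "path_step \<pi> p i =
    (if cross centered_pos i p then C
     else if \<exists>y\<in>S. swap centered_pos i p y \<and> centered_pos (i - 1) p < centered_pos (i - 1) y then R
     else if \<exists>y\<in>S. swap centered_pos i p y \<and> centered_pos i p < centered_pos i y then L else P)"
proof (cases "cross centered_pos i p")
  case True
  then have "\<exists>s. crossing_switch (\<pi> (i - 1)) (\<pi> i) s \<and> p \<in> set s"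
    using cross_iff[OF assms, of i] by blast
  then show ?thesis unfolding path_step_def if_P[OF True] by (rule if_P)
next
  case nc: False
  then have noC: "\<not> (\<exists>s. crossing_switch (\<pi> (i - 1)) (\<pi> i) s \<and> p \<in> set s)"
    using cross_iff[OF assms, of i] by blast
  show ?thesis
  proof (cases "\<exists>y\<in>S. swap centered_pos i p y")
    case True
    then obtain y where y: "y \<in> S" "swap centered_pos i p y" by blast
    have un: "z = y" if "z \<in> S" "swap centered_pos i p z" for z
      using swap_partner[OF assms y(1) that(1) nc y(2) that(2)] by simp
    have "\<not> (\<forall>s\<in>switches (\<pi> (i - 1)) (\<pi> i). p \<notin> set s)"
      using swap_iff_switch[OF assms y(1) swap_neq[OF y(2)]] y(2) by blast
    moreover have "(\<exists>z\<in>S. swap centered_pos i p z \<and> centered_pos (i - 1) p < centered_pos (i - 1) z)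
      \<longleftrightarrow> pos (\<pi> (i - 1)) p < pos (\<pi> i) p"
      using un y noncrossing_swap_pos(1)[OF assms y(1) nc y(2)] centered_pos_less by blast
    moreover have "(\<exists>z\<in>S. swap centered_pos i p z \<and> centered_pos i p < centered_pos i z)
      \<longleftrightarrow> \<not> pos (\<pi> (i - 1)) p < pos (\<pi> i) p"
      using un y noncrossing_swap_pos(1)[OF assms y(1) nc y(2)] centered_pos_less 
      unfolding swap_def by blast
    ultimately show ?thesis unfolding path_step_def if_not_P[OF noC] if_not_P[OF nc] by auto
  next
    case False
    have "p \<notin> set s" if s: "s \<in> switches (\<pi> (i - 1)) (\<pi> i)" for s
    proof
      assume p: "p \<in> set s"
      have sb: "s \<in> set (blocks i)" "2 \<le> length s" using s by (auto simp: switches_eq)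
      have "distinct s" using sb(1) permutation(1)[of "i - 1"]
        by (auto simp: distinct_concat_iff simp flip: concat_blocks(1))
      then have "\<not> set s \<subseteq> {p}" using sb(2) distinct_card[of s] card_mono[of "{p}" "set s"] by auto
      then obtain q where q: "q \<in> set s" "q \<noteq> p" by blast
      have "q \<in> S" using q sb permutation(2)[of "i - 1"] by (auto simp flip: concat_blocks(1))
      then show False using False swap_iff_block[OF assms] sb p q by blast
    qed
    then show ?thesis unfolding path_step_def if_not_P[OF noC] if_not_P[OF nc] using False by auto
  qed
qed

section \<open>Paths\<close>

definition mirror_letter :: "path_letter \<Rightarrow> path_letter" where
  "mirror_letter l = (case l of R \<Rightarrow> L | L \<Rightarrow> R | C \<Rightarrow> C | P \<Rightarrow> P)"

text \<open>A point moves to the right exactly if its conjugate moves to the left. In terms of swaps: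
  since \<open>p\<close> and \<open>y\<close> change order, \<open>p\<close> is to the left of \<open>y\<close> after the swap iff the conjugate of \<open>p\<close> is to the
  left of the conjugate of \<open>y\<close> before it.\<close>

lemma path_step_bar:
  assumes "p \<in> S" shows "path_step \<pi> (bar p) i = mirror_letter (path_step \<pi> p i)"
proof (cases "cross centered_pos i p")
  case True
  then show ?thesis using path_step_eq bar(1) assms cross_bar by (simp add: mirror_letter_def)
next
  case nc: False
  have ex_bar: "(\<exists>y\<in>S. Q y) \<longleftrightarrow> (\<exists>y\<in>S. Q (bar y))" for Q
    using bar(1) bar_bar by metis
  have before: "swap centered_pos i (bar p) (bar y) \<and> centered_pos (i - 1) (bar p) < centered_pos (i - 1) (bar y)
    \<longleftrightarrow> swap centered_pos i p y \<and> centered_pos i p < centered_pos i y"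
    and after: "swap centered_pos i (bar p) (bar y) \<and> centered_pos i (bar p) < centered_pos i (bar y)
    \<longleftrightarrow> swap centered_pos i p y \<and> centered_pos (i - 1) p < centered_pos (i - 1) y" if "y \<in> S" for y
    using x_eq_iff[OF assms that, of i] x_eq_iff[OF assms that, of "i - 1"] assms that
    by (auto simp: swap_def centered_pos_bar)
  have R: "(\<exists>y\<in>S. swap centered_pos i (bar p) y \<and> centered_pos (i - 1) (bar p) < centered_pos (i - 1) y)
    \<longleftrightarrow> (\<exists>y\<in>S. swap centered_pos i p y \<and> centered_pos i p < centered_pos i y)"
    by (subst ex_bar) (simp add: before cong: bex_cong)
  have L: "(\<exists>y\<in>S. swap centered_pos i (bar p) y \<and> centered_pos i (bar p) < centered_pos i y)
    \<longleftrightarrow> (\<exists>y\<in>S. swap centered_pos i p y \<and> centered_pos (i - 1) p < centered_pos (i - 1) y)"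
    by (subst ex_bar) (simp add: after cong: bex_cong)
  have "\<not> ((\<exists>y\<in>S. swap centered_pos i p y \<and> centered_pos (i - 1) p < centered_pos (i - 1) y)
    \<and> (\<exists>y\<in>S. swap centered_pos i p y \<and> centered_pos i p < centered_pos i y))"
    using swap_partner[OF assms _ _ nc] unfolding swap_def by blast
  then show ?thesis
    unfolding path_step_eq[OF assms] path_step_eq[OF bar(1)[OF assms]] R L
    using nc cross_bar[OF assms] by (auto simp: mirror_letter_def)
qed

end

text \<open>Splitting off constant initial runs one after another turns a path into its block form; runs may be empty.\<close>

lemma map_upto_constant_prefix:
  assumes "a \<le> b" "b \<le> c + 1" "\<And>i. a \<le> i \<Longrightarrow> i < b \<Longrightarrow> f i = v"
  shows "map f [a..c] = replicate (nat (b - a)) v @ map f [b..c]"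
proof -
  have "[a..c] = [a..b - 1] @ [b..c]"
  proof (cases "b \<le> c")
    case False
    then have "b = c + 1" using assms(2) by simp
    then show ?thesis by simp
  qed (use assms(1) in \<open>rule upto_split1\<close>)
  moreover have "map f [a..b - 1] = replicate (nat (b - a)) v"
    using assms(3) by (auto simp: list_eq_iff_nth_eq nth_upto)
  ultimately show ?thesis by simp
qed

context symmetric_sequence
begin

text \<open>Just before the switch the left half of the centered substring occupies the negative positions, from the
  outside to the center. Crossing reverses the order, so the earlier a point occurs in the substring, the
  farther out it is afterwards.\<close>

lemma crossing_substring_rank:
  assumes "crossing_switch (\<pi> (i - 1)) (\<pi> i) s" "length s = 2 * m" "1 \<le> k" "k \<le> m"
  shows "s ! (k - 1) \<in> outgoing i" "weight i = m" "rank i (s ! (k - 1)) = k" "m \<le> n"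
proof -
  from assms(1) obtain u v where uv: "\<pi> (i - 1) = u @ s @ v" "length u = length v"
    by (auto simp: crossing_switch_def)
  have len: "length u + m = n" using length_permutation[of "i - 1"] uv assms(2) by simp
  then show "m \<le> n" by simp
  have in_S: "q \<in> S" if "q \<in> set s" for q
    using that permutation(2)[of "i - 1"] unfolding uv by auto
  have dist: "distinct s" using permutation(1)[of "i - 1"] unfolding uv by simp
  have pos_s: "pos (\<pi> (i - 1)) (s ! j) = Suc (length u + j)" if "j < 2 * m" for j
    using pos_nth[OF permutation(1), of "length u + j" "i - 1"] that assms(2) by (simp add: uv nth_append)
  have cr: "cross centered_pos i q \<longleftrightarrow> q \<in> set s" if "q \<in> S" for q
    using cross_iff[OF that] crossing_switch_unique assms(1) by blast
  have neg: "centered_pos (i - 1) (s ! j) < 0 \<longleftrightarrow> j < m" if "j < 2 * m" for j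
    unfolding centered_pos_def pos_s[OF that] using len by auto
  have out: "outgoing i = (!) s ` {..<m}"
  proof (intro equalityI subsetI)
    fix q assume "q \<in> outgoing i"
    then have "q \<in> set s" "centered_pos (i - 1) q < 0" using cr by (auto simp: outgoing_eq)
    then show "q \<in> (!) s ` {..<m}" using neg assms(2) by (auto simp: in_set_conv_nth)
  next
    fix q assume "q \<in> (!) s ` {..<m}"
    then obtain j where j: "j < m" "q = s ! j" by auto
    then have "q \<in> set s" using assms(2) by simp
    then show "q \<in> outgoing i" using neg[of j] j cr in_S by (auto simp: outgoing_eq)
  qed
  have inj: "inj_on ((!) s) {..<m}" using dist assms(2) by (intro inj_on_nth) auto
  show "weight i = m" unfolding weight_def out using inj by (simp add: card_image)
  show p: "s ! (k - 1) \<in> outgoing i" unfolding out using assms by auto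
  have "{q \<in> outgoing i. centered_pos i (s ! (k - 1)) \<le> centered_pos i q} = (!) s ` {..<k}"
  proof -
    have "centered_pos i (s ! (k - 1)) \<le> centered_pos i (s ! j) \<longleftrightarrow> j < k" if "j < m" for j
    proof -
      have "s ! j \<in> outgoing i" using out that by blast
      then have "centered_pos i (s ! (k - 1)) \<le> centered_pos i (s ! j) \<longleftrightarrow>
        centered_pos (i - 1) (s ! j) \<le> centered_pos (i - 1) (s ! (k - 1))"
        using cross_reverses[of "s ! j" "s ! (k - 1)" i] p by (auto simp: outgoing_eq)
      also have "\<dots> \<longleftrightarrow> j < k" using that assms pos_s[of j] pos_s[of "k - 1"]
        by (auto simp: centered_pos_def)
      finally show ?thesis .
    qed
    then show ?thesis unfolding out using assms(4) by auto
  qed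
  then show "rank i (s ! (k - 1)) = k"
    unfolding rank_def using inj_on_subset[OF inj, of "{..<k}"] assms(4) by (simp add: card_image)
qed

lemma path_of_outgoing:
  assumes "p \<in> outgoing 1" "rank 1 p = k" "weight 1 = m" "1 \<le> k" "k \<le> m" "m \<le> n"
  shows "point_path n \<pi> p = [C] @ replicate (k - 1) P @ replicate (n - m) R
    @ replicate (2 * (m - k) + 1) P @ replicate (n - m) L @ replicate (k - 1) P"
proof -
  have p: "p \<in> S" "cross centered_pos 1 p" using assms(1) by (auto simp: outgoing_def)
  let ?f = "path_step \<pi> p"
  have first: "?f i = C" if "1 \<le> i" "i < 2" for i
  proof -
    have "i = 1" using that by simp
    then show ?thesis using path_step_eq[OF p(1), of 1] p(2) by simp
  qed
  have later: "?f i = (if 1 + int k \<le> i \<and> i < 1 + int k + int (n - m) then R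
      else if 1 + 2 * int n - int k - int (n - m) < i \<and> i \<le> 1 + 2 * int n - int k then L else P)"
    if "1 < i" "i \<le> 2 * int n" for i
  proof -
    have "\<not> cross centered_pos i p" using cross_unique[OF p(1) _ p(2), of i] that by auto
    then show ?thesis
      unfolding path_step_eq[OF p(1)] using outward_moves[OF assms(1), of i] inward_moves[OF assms(1), of i] that assms(2,3)
      by simp
  qed
  \<comment> \<open>The first moves of the runs of letters R, P, L and P.\<close>
  define a b c e where "a = 1 + int k" and "b = a + int (n - m)"
    and "c = 1 + 2 * int n - int k - int (n - m) + 1" and "e = 2 + 2 * int n - int k"
  note d = a_def b_def c_def e_def
  have "point_path n \<pi> p = map ?f [1..2 * int n]" by (simp add: point_path_def)
  also have "\<dots> = replicate (nat (2 - 1)) C @ map ?f [2..2 * int n]"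
    using first assms by (intro map_upto_constant_prefix) auto
  also have "map ?f [2..2 * int n] = replicate (nat (a - 2)) P @ map ?f [a..2 * int n]"
    using later assms by (intro map_upto_constant_prefix) (auto simp: d of_nat_diff)
  also have "map ?f [a..2 * int n] = replicate (nat (b - a)) R @ map ?f [b..2 * int n]"
    using later assms by (intro map_upto_constant_prefix) (auto simp: d of_nat_diff)
  also have "map ?f [b..2 * int n] = replicate (nat (c - b)) P @ map ?f [c..2 * int n]"
    using later assms by (intro map_upto_constant_prefix) (auto simp: d of_nat_diff)
  also have "map ?f [c..2 * int n] = replicate (nat (e - c)) L @ map ?f [e..2 * int n]"
    using later assms by (intro map_upto_constant_prefix) (auto simp: d of_nat_diff)
  also have "map ?f [e..2 * int n] = replicate (nat (2 * int n + 1 - e)) P @ map ?f [2 * int n + 1..2 * int n]"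
    using later assms by (intro map_upto_constant_prefix) (auto simp: d of_nat_diff)
  finally have "point_path n \<pi> p = [C] @ replicate (nat (a - 2)) P @ replicate (nat (b - a)) R
    @ replicate (nat (c - b)) P @ replicate (nat (e - c)) L @ replicate (nat (2 * int n + 1 - e)) P"
    by simp
  moreover have "nat (a - 2) = k - 1" "nat (b - a) = n - m" "nat (c - b) = 2 * (m - k) + 1"
    "nat (e - c) = n - m" "nat (2 * int n + 1 - e) = k - 1"
    using assms by (auto simp: d of_nat_diff)
  ultimately show ?thesis by simp
qed

lemma point_path_bar:
  "p \<in> S \<Longrightarrow> point_path n \<pi> (bar p) = map mirror_letter (point_path n \<pi> p)"
  by (simp add: point_path_def path_step_bar)

end

theorem theorem3p1:
  fixes S :: "'a set" and \<pi> :: "int \<Rightarrow> 'a list" and h n t k :: nat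
    and d :: "nat list" and s1 :: "'a list"
  assumes "allowable_sequence S \<pi> h"
    and "card S = 2 * n"
    and "centrally_symmetric S \<pi>"
    and "noncentral_general_position \<pi>"
    and "even_near_critical S h"
    and "central_signature \<pi> h d"
    and "length d = t" and "2 \<le> t"
    and "crossing_switch (\<pi> 0) (\<pi> 1) s1"
    and "1 \<le> k" and "k \<le> d ! 0"
  shows "point_path n \<pi> (s1 ! (k - 1)) =
      [C] @ replicate (k - 1) P @ replicate (n - d ! 0) R @ replicate (2 * (d ! 0 - k) + 1) P
        @ replicate (n - d ! 0) L @ replicate (k - 1) P \<and>
    point_path n \<pi> (conjugate_point S \<pi> (s1 ! (k - 1))) =
      [C] @ replicate (k - 1) P @ replicate (n - d ! 0) L @ replicate (2 * (d ! 0 - k) + 1) P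
        @ replicate (n - d ! 0) R @ replicate (k - 1) P"
proof -
  interpret symmetric_sequence S \<pi> h n
    using assms(1-5) by (simp add: symmetric_sequence_def symmetric_sequence_axioms_def even_near_critical_def)
  let ?p = "s1 ! (k - 1)"
  have cs: "crossing_switch (\<pi> (1 - 1)) (\<pi> 1) s1" using assms(9) by simp
  have "[1..int h] = 1 # [2..int h]" using halfperiod_pos upto_rec1[of 1 "int h"] by simp
  then have "crossing_moves \<pi> h = 1 # filter (\<lambda>i. \<exists>s. crossing_switch (\<pi> (i - 1)) (\<pi> i) s) [2..int h]"
    unfolding crossing_moves_def using cs by auto
  then obtain s where "crossing_switch (\<pi> (1 - 1)) (\<pi> 1) s" "length s = 2 * d ! 0"
    using assms(6) unfolding central_signature_def by (auto simp: list_all2_Cons1)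
  then have "length s1 = 2 * d ! 0" using crossing_switch_unique[of 1] cs by auto
  from crossing_substring_rank[OF cs this assms(10,11)]
  have p: "?p \<in> outgoing 1" "weight 1 = d ! 0" "rank 1 ?p = k" "d ! 0 \<le> n" .
  note path = path_of_outgoing[OF p(1,3,2) assms(10,11) p(4)]
  moreover have "point_path n \<pi> (bar ?p) = map mirror_letter (point_path n \<pi> ?p)"
    using p(1) by (intro point_path_bar) (simp add: outgoing_def)
  ultimately show ?thesis by (simp add: mirror_letter_def)
qed

end
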